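(* Let $A$ be a 4-dimensional complex vector space with a basis $\{e_1,\dots,e_4\}$ and let $\{e_1^*,\dots,e_4^*\}$ be the dual basis of $A^*$. On $A\oplus A^*$ define the bilinear form $(x+\xi,y+\eta)_+=\langle x,\eta\rangle+\langle\xi,y\rangle$, i.e. the form with matrix $\begin{pmatrix}0&I_4\\ I_4&0\end{pmatrix}$ in the basis $\{e_1,\dots,e_4,e_1^*,\dots,e_4^*\}$. We get the following families of 8-dimensional pseudo-metric 3-Lie algebras $(A\oplus A^*,(\cdot,\cdot)_+)$, where all parameters are arbitrary constants. (1) The non-zero product of the 3-Lie algebra structure on $A\oplus A^*$ is given by $[e_1,e_2,e_3]=e_4$, $[e_1,e_2,e_4]=e_3$, $[e_1,e_3,e_4]=e_2$, $[e_2,e_3,e_4]=e_1$; $[e_1^*,e_2^*,e_3^*]^*=ke_4^*$, $[e_1^*,e_2^*,e_4^*]^*=ke_3^*$, $[e_1^*,e_3^*,e_4^*]^*=ke_2^*$, $[e_2^*,e_3^*,e_4^*]^*=ke_1^*$; $[e_i,e_j^*,e_k^*]=e_m^*$, $[e_i,e_j,e_k^*]=e_m^*$, where the last line holds for $i<j<k$ and $m$ distinct from $i,j,k$. They correspond to the double construction 3-Lie bialgebras $B_1$ described in the context. (2) The non-zero product of the 3-Lie algebra structure on $A\oplus A^*$ is given by $[e_2,e_3,e_4]=e_1$; $[e_1^*,e_2^*,e_3^*]^*=k_1e_2^*+k_3e_3^*+c_3e_4^*$, $[e_1^*,e_2^*,e_4^*]^*=k_2e_2^*+c_2e_3^*-k_3e_4^*$,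 $[e_1^*,e_3^*,e_4^*]^*=c_1e_2^*-k_2e_3^*+k_1e_4^*$; $[e_1,e_2,e_1^*]=-e_3^*$, $[e_1,e_3,e_1^*]=e_2^*$, $[e_2,e_3,e_1^*]=-e_1^*$; $[e_2,e_1^*,e_2^*]=-k_1e_3-k_2e_4$, $[e_2,e_2^*,e_3^*]=-k_1e_1$, $[e_2,e_1^*,e_3^*]=k_1e_2-c_1e_4$, $[e_2,e_2^*,e_4^*]=-k_2e_1$, $[e_2,e_1^*,e_4^*]=k_2e_2+c_1e_3$, $[e_2,e_3^*,e_4^*]=-c_1e_1$; $[e_3,e_1^*,e_2^*]=-k_3e_3-c_2e_4$, $[e_3,e_2^*,e_3^*]=-k_3e_1$, $[e_3,e_1^*,e_3^*]=k_3e_2+k_2e_4$, $[e_3,e_2^*,e_4^*]=-c_2e_1$, $[e_3,e_1^*,e_4^*]=c_2e_2-k_2e_3$, $[e_3,e_3^*,e_4^*]=k_2e_1$; $[e_4,e_1^*,e_2^*]=-c_3e_3+k_3e_4$, $[e_4,e_2^*,e_3^*]=-c_3e_1$, $[e_4,e_1^*,e_3^*]=c_3e_2-k_1e_4$, $[e_4,e_2^*,e_4^*]=k_3e_1$, $[e_4,e_1^*,e_4^*]=-k_3e_2+k_1e_3$, $[e_4,e_3^*,e_4^*]=-k_1e_1$. They correspond to the double construction 3-Lie bialgebras $B_2$ described in the context. (3) The non-zero product of the 3-Lie algebra structure on $A\oplus A^*$ is given by $[e_2,e_3,e_4]=e_1$, $[e_1,e_3,e_4]=e_2$; $[e_1^*,e_2^*,e_3^*]^*=ke_3^*+c_2e_4^*$,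 $[e_1^*,e_2^*,e_4^*]^*=c_1e_3^*-ke_4^*$; $[e_2,e_3,e_1^*]=-e_4^*$, $[e_3,e_4,e_1^*]=-e_2^*$, $[e_2,e_4,e_1^*]=e_3^*$, $[e_1,e_4,e_2^*]=e_3^*$, $[e_1,e_3,e_2^*]=-e_4^*$, $[e_3,e_4,e_2^*]=-e_1^*$; $[e_3,e_1^*,e_2^*]=-ke_3-c_1e_4$, $[e_4,e_1^*,e_2^*]=-c_2e_3+ke_4$, $[e_3,e_1^*,e_3^*]=ke_2$, $[e_4,e_1^*,e_3^*]=c_2e_2$, $[e_3,e_1^*,e_4^*]=c_1e_2$, $[e_4,e_1^*,e_4^*]=-ke_2$, $[e_3,e_2^*,e_3^*]=-ke_1$, $[e_4,e_2^*,e_3^*]=-c_2e_1$, $[e_3,e_2^*,e_4^*]=-c_1e_1$, $[e_4,e_2^*,e_4^*]=ke_1$. They correspond to the double construction 3-Lie bialgebras $B_3$ described in the context. (4) The non-zero product of the 3-Lie algebra structure on $A\oplus A^*$ is given by $[e_1,e_2,e_4]=e_3$, $[e_1,e_3,e_4]=e_2$, $[e_2,e_3,e_4]=e_1$, $[e_1^*,e_2^*,e_3^*]^*=ce_4^*$; $[e_1,e_3,e_2^*]=-e_4^*$, $[e_1,e_2,e_3^*]=-e_4^*$, $[e_1,e_4,e_2^*]=e_3^*$, $[e_1,e_4,e_3^*]=e_2^*$, $[e_2,e_3,e_1^*]=-e_4^*$, $[e_2,e_4,e_1^*]=e_3^*$, $[e_2,e_4,e_3^*]=-e_1^*$, $[e_3,e_4,e_2^*]=-e_1^*$,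 $[e_3,e_4,e_1^*]=-e_2^*$; $[e_4,e_1^*,e_2^*]=-ce_3$, $[e_4,e_1^*,e_3^*]=ce_2$, $[e_4,e_2^*,e_3^*]=-ce_1$. They correspond to the double construction 3-Lie bialgebras $B_4$ described in the context.
   Context: A 3-Lie algebra is a vector space $A$ with a trilinear, totally skew-symmetric bracket $[\cdot,\cdot,\cdot]:\otimes^3A\to A$ such that for all $x_1,\dots,x_5\in A$: $[x_1,x_2,[x_3,x_4,x_5]]=[[x_1,x_2,x_3],x_4,x_5]+[x_3,[x_1,x_2,x_4],x_5]+[x_3,x_4,[x_1,x_2,x_5]]$. It is pseudo-metric if there is a nondegenerate symmetric bilinear form $(\cdot,\cdot)$ on it that is invariant: $([x_1,x_2,x_3],x_4)+([x_1,x_2,x_4],x_3)=0$ for all $x_i$. Products are listed up to skew-symmetry; $[\cdot,\cdot,\cdot]^*$ denotes the bracket restricted to $A^*$. Put $\mathrm{ad}_{x,y}z=[x,y,z]$. A double construction 3-Lie bialgebra is a pair $(A,\Delta)$ of a 3-Lie algebra $A$ and a linear map $\Delta:A\to A\otimes A\otimes A$ such that the dual map $\Delta^*:A^*\otimes A^*\otimes A^*\to A^*$ defines a 3-Lie bracket $[\cdot,\cdot,\cdot]^*$ on $A^*$ and for all $x,y,z\in A$: $\Delta([x,y,z])=(\mathrm{id}\otimes\mathrm{id}\otimes\mathrm{ad}_{y,z})\Delta(x)+(\mathrm{id}\otimes\mathrm{id}\otimes\mathrm{ad}_{z,x})\Delta(y)+(\mathrm{id}\otimes\mathrm{id}\otimes\mathrm{ad}_{x,y})\Delta(z)$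 and $\Delta([x,y,z])=(\mathrm{id}\otimes\mathrm{id}\otimes\mathrm{ad}_{y,z})\Delta(x)+(\mathrm{id}\otimes\mathrm{ad}_{y,z}\otimes\mathrm{id})\Delta(x)+(\mathrm{ad}_{y,z}\otimes\mathrm{id}\otimes\mathrm{id})\Delta(x)$. The correspondence between double construction 3-Lie bialgebras and pseudo-metric 3-Lie algebras on $A\oplus A^*$ is through the standard Manin triple $((A\oplus A^*,(\cdot,\cdot)_+),A,A^* )$, where $A\oplus A^*$ carries the bracket $$[x+\xi,y+\eta,z+\gamma]=[x,y,z]+\mathrm{ad}^*_{x,y}\gamma+\mathrm{ad}^*_{y,z}\xi+\mathrm{ad}^*_{z,x}\eta+\mathfrak{ad}^*_{\xi,\eta}z+\mathfrak{ad}^*_{\eta,\gamma}x+\mathfrak{ad}^*_{\gamma,\xi}y+[\xi,\eta,\gamma]^*,$$ with $\langle\mathrm{ad}^*_{x,y}\xi,z\rangle=-\langle\xi,[x,y,z]\rangle$ and $\langle\mathfrak{ad}^*_{\xi,\eta}x,\gamma\rangle=-\langle x,[\xi,\eta,\gamma]^*\rangle$. The bialgebras (with $v_1\wedge v_2\wedge v_3=\sum_{\sigma\in S_3}\mathrm{sgn}(\sigma)v_{\sigma(1)}\otimes v_{\sigma(2)}\otimes v_{\sigma(3)}$ and non-zero brackets of $A$ up to skew-symmetry): $B_1$: $[e_1,e_2,e_3]=e_4$, $[e_1,e_2,e_4]=e_3$, $[e_1,e_3,e_4]=e_2$, $[e_2,e_3,e_4]=e_1$; $\Delta(e_1)=ke_2\wedge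 e_3\wedge e_4$, $\Delta(e_2)=ke_1\wedge e_3\wedge e_4$, $\Delta(e_3)=ke_1\wedge e_2\wedge e_4$, $\Delta(e_4)=ke_1\wedge e_2\wedge e_3$. $B_2$: $[e_2,e_3,e_4]=e_1$; $\Delta(e_1)=0$, $\Delta(e_2)=k_1e_1\wedge e_2\wedge e_3+k_2e_1\wedge e_2\wedge e_4+c_1e_1\wedge e_3\wedge e_4$, $\Delta(e_3)=k_3e_1\wedge e_2\wedge e_3-k_2e_1\wedge e_3\wedge e_4+c_2e_1\wedge e_2\wedge e_4$, $\Delta(e_4)=-k_3e_1\wedge e_2\wedge e_4+k_1e_1\wedge e_3\wedge e_4+c_3e_1\wedge e_2\wedge e_3$. $B_3$: $[e_2,e_3,e_4]=e_1$, $[e_1,e_3,e_4]=e_2$; $\Delta(e_1)=\Delta(e_2)=0$, $\Delta(e_3)=ke_1\wedge e_2\wedge e_3+c_1e_1\wedge e_2\wedge e_4$, $\Delta(e_4)=-ke_1\wedge e_2\wedge e_4+c_2e_1\wedge e_2\wedge e_3$. $B_4$: $[e_1,e_2,e_4]=e_3$, $[e_1,e_3,e_4]=e_2$, $[e_2,e_3,e_4]=e_1$; $\Delta(e_1)=\Delta(e_2)=\Delta(e_3)=0$, $\Delta(e_4)=ce_1\wedge e_2\wedge e_3$.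
   Formalization: In (1) the mixed products, false as printed, are replaced by [e_i,e_j,e_k*]=±e_m* and [e_i,e_j*,e_k*]=±k e_m for all distinct indices, with the signs forced by invariance; in (2) the products with e_1* are corrected to [e_2,e_3,e_1*]=-e_4*, [e_2,e_4,e_1*]=e_3*, [e_3,e_4,e_1*]=-e_2*. *)

theory Defs
  imports Complex_Main "HOL-Library.Function_Algebras" "HOL-Library.Product_Plus"
begin

section \<open>3-Lie algebras on a subspace of a complex vector space\<close>

text \<open>
  The scalar multiplication \<open>s\<close> is explicit, as in \<^locale>\<open>vector_space\<close>. The carrier \<open>V\<close> is a
  subspace of the ambient type, so that the dual space (a subspace of a function type) and
  the double can be treated on the same footing as \<open>A\<close>, whose carrier is \<^term>\<open>UNIV\<close>.
\<close>

definition trilinear_on ::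
  "(complex \<Rightarrow> 'v::ab_group_add \<Rightarrow> 'v) \<Rightarrow> 'v set \<Rightarrow> ('v \<Rightarrow> 'v \<Rightarrow> 'v \<Rightarrow> 'v) \<Rightarrow> bool" where
  "trilinear_on s V br \<longleftrightarrow>
     (\<forall>x\<in>V. \<forall>y\<in>V. \<forall>z\<in>V. br x y z \<in> V) \<and>
     (\<forall>x\<in>V. \<forall>x'\<in>V. \<forall>y\<in>V. \<forall>z\<in>V.
        br (x + x') y z = br x y z + br x' y z \<and>
        br y (x + x') z = br y x z + br y x' z \<and>
        br y z (x + x') = br y z x + br y z x') \<and>
     (\<forall>c. \<forall>x\<in>V. \<forall>y\<in>V. \<forall>z\<in>V.
        br (s c x) y z = s c (br x y z) \<and>
        br x (s c y) z = s c (br x y z) \<and>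
        br x y (s c z) = s c (br x y z))"

text \<open>Skew-symmetry is stated for the two adjacent transpositions, which generate $S_3$.\<close>

definition three_lie_algebra ::
  "(complex \<Rightarrow> 'v::ab_group_add \<Rightarrow> 'v) \<Rightarrow> 'v set \<Rightarrow> ('v \<Rightarrow> 'v \<Rightarrow> 'v \<Rightarrow> 'v) \<Rightarrow> bool" where
  "three_lie_algebra s V br \<longleftrightarrow>
     vector_space s \<and> module.subspace s V \<and> trilinear_on s V br \<and>
     (\<forall>x\<in>V. \<forall>y\<in>V. \<forall>z\<in>V. br y x z = - br x y z \<and> br x z y = - br x y z) \<and>
     (\<forall>x1\<in>V. \<forall>x2\<in>V. \<forall>x3\<in>V. \<forall>x4\<in>V. \<forall>x5\<in>V.
        br x1 x2 (br x3 x4 x5) =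
          br (br x1 x2 x3) x4 x5 + br x3 (br x1 x2 x4) x5 + br x3 x4 (br x1 x2 x5))"

definition bilinear_form_on ::
  "(complex \<Rightarrow> 'v::ab_group_add \<Rightarrow> 'v) \<Rightarrow> 'v set \<Rightarrow> ('v \<Rightarrow> 'v \<Rightarrow> complex) \<Rightarrow> bool" where
  "bilinear_form_on s V B \<longleftrightarrow>
     (\<forall>x\<in>V. \<forall>x'\<in>V. \<forall>y\<in>V.
        B (x + x') y = B x y + B x' y \<and> B y (x + x') = B y x + B y x') \<and>
     (\<forall>c. \<forall>x\<in>V. \<forall>y\<in>V. B (s c x) y = c * B x y \<and> B x (s c y) = c * B x y)"

definition pseudo_metric_three_lie_algebra ::
  "(complex \<Rightarrow> 'v::ab_group_add \<Rightarrow> 'v) \<Rightarrow> 'v set \<Rightarrow> ('v \<Rightarrow> 'v \<Rightarrow> 'v \<Rightarrow> 'v) \<Rightarrow>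
     ('v \<Rightarrow> 'v \<Rightarrow> complex) \<Rightarrow> bool" where
  "pseudo_metric_three_lie_algebra s V br B \<longleftrightarrow>
     three_lie_algebra s V br \<and> bilinear_form_on s V B \<and>
     (\<forall>x\<in>V. \<forall>y\<in>V. B x y = B y x) \<and>
     (\<forall>x\<in>V. (\<forall>y\<in>V. B x y = 0) \<longrightarrow> x = 0) \<and>
     (\<forall>x1\<in>V. \<forall>x2\<in>V. \<forall>x3\<in>V. \<forall>x4\<in>V. B (br x1 x2 x3) x4 + B (br x1 x2 x4) x3 = 0)"

definition manin_triple ::
  "(complex \<Rightarrow> 'v::ab_group_add \<Rightarrow> 'v) \<Rightarrow> 'v set \<Rightarrow> ('v \<Rightarrow> 'v \<Rightarrow> 'v \<Rightarrow> 'v) \<Rightarrow>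
     ('v \<Rightarrow> 'v \<Rightarrow> complex) \<Rightarrow> 'v set \<Rightarrow> 'v set \<Rightarrow> bool" where
  "manin_triple s V br B V1 V2 \<longleftrightarrow>
     pseudo_metric_three_lie_algebra s V br B \<and>
     three_lie_algebra s V1 br \<and> three_lie_algebra s V2 br \<and>
     (\<forall>x\<in>V1. \<forall>y\<in>V1. B x y = 0) \<and> (\<forall>x\<in>V2. \<forall>y\<in>V2. B x y = 0) \<and>
     V1 \<inter> V2 = {0} \<and> V = {x + y | x y. x \<in> V1 \<and> y \<in> V2} \<and>
     (\<forall>x\<in>V1. \<forall>y\<in>V1. \<forall>z\<in>V2. br x y z \<in> V2) \<and>
     (\<forall>x\<in>V2. \<forall>y\<in>V2. \<forall>z\<in>V1. br x y z \<in> V1)"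

section \<open>Dual space and tensors\<close>

definition fscale :: "complex \<Rightarrow> ('a \<Rightarrow> complex) \<Rightarrow> ('a \<Rightarrow> complex)" where
  "fscale c \<xi> = (\<lambda>x. c * \<xi> x)"

definition dual_space :: "(complex \<Rightarrow> 'a::ab_group_add \<Rightarrow> 'a) \<Rightarrow> ('a \<Rightarrow> complex) set" where
  "dual_space s = {\<xi>. Vector_Spaces.linear s (*) \<xi>}"

text \<open>
  \<open>A \<otimes> A \<otimes> A\<close> is realised inside the trilinear forms on the dual space, a pure tensor
  \<open>u \<otimes> v \<otimes> w\<close> being the form \<open>(\<xi>, \<eta>, \<zeta>) \<mapsto> \<xi>(u) \<eta>(v) \<zeta>(w)\<close>. Forms are extended by \<open>0\<close> to
  arguments that are not linear functionals, so that tensors are equal iff they agree as forms.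
\<close>

type_synonym 'a tensor3 = "('a \<Rightarrow> complex) \<Rightarrow> ('a \<Rightarrow> complex) \<Rightarrow> ('a \<Rightarrow> complex) \<Rightarrow> complex"

definition tscale :: "complex \<Rightarrow> 'a tensor3 \<Rightarrow> 'a tensor3" where
  "tscale c T = (\<lambda>\<xi> \<eta> \<zeta>. c * T \<xi> \<eta> \<zeta>)"

definition pure_tensor ::
  "(complex \<Rightarrow> 'a::ab_group_add \<Rightarrow> 'a) \<Rightarrow> 'a \<Rightarrow> 'a \<Rightarrow> 'a \<Rightarrow> 'a tensor3" where
  "pure_tensor s u v w = (\<lambda>\<xi> \<eta> \<zeta>.
     if \<xi> \<in> dual_space s \<and> \<eta> \<in> dual_space s \<and> \<zeta> \<in> dual_space s then \<xi> u * \<eta> v * \<zeta> w else 0)"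

definition tensor_cube :: "(complex \<Rightarrow> 'a::ab_group_add \<Rightarrow> 'a) \<Rightarrow> 'a tensor3 set" where
  "tensor_cube s = module.span tscale {pure_tensor s u v w | u v w. True}"

text \<open>The induced map \<open>f \<otimes> g \<otimes> h\<close>, for linear \<open>f\<close>, \<open>g\<close>, \<open>h\<close>; see \<open>tensor_map_pure\<close> below.\<close>

definition tensor_map ::
  "(complex \<Rightarrow> 'a::ab_group_add \<Rightarrow> 'a) \<Rightarrow> ('a \<Rightarrow> 'a) \<Rightarrow> ('a \<Rightarrow> 'a) \<Rightarrow> ('a \<Rightarrow> 'a) \<Rightarrow>
     'a tensor3 \<Rightarrow> 'a tensor3" where
  "tensor_map s f g h T = (\<lambda>\<xi> \<eta> \<zeta>.
     if \<xi> \<in> dual_space s \<and> \<eta> \<in> dual_space s \<and> \<zeta> \<in> dual_space s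
     then T (\<xi> \<circ> f) (\<eta> \<circ> g) (\<zeta> \<circ> h) else 0)"

lemma dual_space_comp:
  assumes "Vector_Spaces.linear s s f" "\<xi> \<in> dual_space s"
  shows "\<xi> \<circ> f \<in> dual_space s"
  using assms unfolding dual_space_def by (auto intro: Vector_Spaces.linear_compose)

lemma tensor_map_pure:
  assumes "Vector_Spaces.linear s s f" "Vector_Spaces.linear s s g" "Vector_Spaces.linear s s h"
  shows "tensor_map s f g h (pure_tensor s u v w) = pure_tensor s (f u) (g v) (h w)"
  using assms by (auto simp: tensor_map_def pure_tensor_def dual_space_comp intro!: ext)

definition wedge3 ::
  "(complex \<Rightarrow> 'a::ab_group_add \<Rightarrow> 'a) \<Rightarrow> 'a \<Rightarrow> 'a \<Rightarrow> 'a \<Rightarrow> 'a tensor3" where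
  "wedge3 s u v w =
     pure_tensor s u v w + pure_tensor s v w u + pure_tensor s w u v
     - pure_tensor s v u w - pure_tensor s u w v - pure_tensor s w v u"

section \<open>Double construction 3-Lie bialgebras\<close>

text \<open>The value of \<open>\<Delta>\<^sup>*\<close> on \<open>\<xi> \<otimes> \<eta> \<otimes> \<zeta>\<close>, that is \<open>x \<mapsto> \<langle>\<Delta> x, \<xi> \<otimes> \<eta> \<otimes> \<zeta>\<rangle>\<close>.\<close>

definition dual_bracket ::
  "('a \<Rightarrow> 'a tensor3) \<Rightarrow> ('a \<Rightarrow> complex) \<Rightarrow> ('a \<Rightarrow> complex) \<Rightarrow> ('a \<Rightarrow> complex) \<Rightarrow> ('a \<Rightarrow> complex)" where
  "dual_bracket \<Delta> \<xi> \<eta> \<zeta> = (\<lambda>x. \<Delta> x \<xi> \<eta> \<zeta>)"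

definition double_construction_bialgebra ::
  "(complex \<Rightarrow> 'a::ab_group_add \<Rightarrow> 'a) \<Rightarrow> ('a \<Rightarrow> 'a \<Rightarrow> 'a \<Rightarrow> 'a) \<Rightarrow> ('a \<Rightarrow> 'a tensor3) \<Rightarrow> bool" where
  "double_construction_bialgebra s br \<Delta> \<longleftrightarrow>
     three_lie_algebra s UNIV br \<and>
     Vector_Spaces.linear s tscale \<Delta> \<and> range \<Delta> \<subseteq> tensor_cube s \<and>
     three_lie_algebra fscale (dual_space s) (dual_bracket \<Delta>) \<and>
     (\<forall>x y z. \<Delta> (br x y z) =
        tensor_map s id id (br y z) (\<Delta> x) + tensor_map s id id (br z x) (\<Delta> y)
        + tensor_map s id id (br x y) (\<Delta> z)) \<and>
     (\<forall>x y z. \<Delta> (br x y z) =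
        tensor_map s id id (br y z) (\<Delta> x) + tensor_map s id (br y z) id (\<Delta> x)
        + tensor_map s (br y z) id id (\<Delta> x))"

section \<open>The double and its standard Manin triple\<close>

definition dscale ::
  "(complex \<Rightarrow> 'a \<Rightarrow> 'a) \<Rightarrow> complex \<Rightarrow> 'a \<times> ('a \<Rightarrow> complex) \<Rightarrow> 'a \<times> ('a \<Rightarrow> complex)" where
  "dscale s c X = (s c (fst X), fscale c (snd X))"

definition double_space ::
  "(complex \<Rightarrow> 'a::ab_group_add \<Rightarrow> 'a) \<Rightarrow> ('a \<times> ('a \<Rightarrow> complex)) set" where
  "double_space s = UNIV \<times> dual_space s"

definition form_plus ::
  "'a \<times> ('a \<Rightarrow> complex) \<Rightarrow> 'a \<times> ('a \<Rightarrow> complex) \<Rightarrow> complex" where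
  "form_plus X Y = snd Y (fst X) + snd X (fst Y)"

definition coad ::
  "('a \<Rightarrow> 'a \<Rightarrow> 'a \<Rightarrow> 'a) \<Rightarrow> 'a \<Rightarrow> 'a \<Rightarrow> ('a \<Rightarrow> complex) \<Rightarrow> ('a \<Rightarrow> complex)" where
  "coad br x y \<xi> = (\<lambda>z. - \<xi> (br x y z))"

text \<open>
  The vector \<open>u\<close> with \<open>\<langle>u, \<gamma>\<rangle> = - \<langle>x, [\<xi>, \<eta>, \<gamma>]\<^sup>*\<rangle>\<close> for all \<open>\<gamma>\<close>; it exists and is unique because
  \<open>A\<close> is finite-dimensional.
\<close>

definition dual_coad ::
  "(complex \<Rightarrow> 'a::ab_group_add \<Rightarrow> 'a) \<Rightarrow> ('a \<Rightarrow> 'a tensor3) \<Rightarrow>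
     ('a \<Rightarrow> complex) \<Rightarrow> ('a \<Rightarrow> complex) \<Rightarrow> 'a \<Rightarrow> 'a" where
  "dual_coad s \<Delta> \<xi> \<eta> x = (THE u. \<forall>\<gamma>\<in>dual_space s. \<gamma> u = - dual_bracket \<Delta> \<xi> \<eta> \<gamma> x)"

definition manin_bracket ::
  "(complex \<Rightarrow> 'a::ab_group_add \<Rightarrow> 'a) \<Rightarrow> ('a \<Rightarrow> 'a \<Rightarrow> 'a \<Rightarrow> 'a) \<Rightarrow> ('a \<Rightarrow> 'a tensor3) \<Rightarrow>
     'a \<times> ('a \<Rightarrow> complex) \<Rightarrow> 'a \<times> ('a \<Rightarrow> complex) \<Rightarrow> 'a \<times> ('a \<Rightarrow> complex) \<Rightarrow>
     'a \<times> ('a \<Rightarrow> complex)" where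
  "manin_bracket s br \<Delta> = (\<lambda>(x, \<xi>) (y, \<eta>) (z, \<gamma>).
     (br x y z + dual_coad s \<Delta> \<xi> \<eta> z + dual_coad s \<Delta> \<eta> \<gamma> x + dual_coad s \<Delta> \<gamma> \<xi> y,
      coad br x y \<gamma> + coad br y z \<xi> + coad br z x \<eta> + dual_bracket \<Delta> \<xi> \<eta> \<gamma>))"

text \<open>The bracket \<open>dbr\<close> on the double corresponds to the bialgebra \<open>(br, \<Delta>)\<close>.\<close>

definition corresponds_to_bialgebra ::
  "(complex \<Rightarrow> 'a::ab_group_add \<Rightarrow> 'a) \<Rightarrow>
     ('a \<times> ('a \<Rightarrow> complex) \<Rightarrow> 'a \<times> ('a \<Rightarrow> complex) \<Rightarrow> 'a \<times> ('a \<Rightarrow> complex) \<Rightarrow> 'a \<times> ('a \<Rightarrow> complex)) \<Rightarrow>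
     ('a \<Rightarrow> 'a \<Rightarrow> 'a \<Rightarrow> 'a) \<Rightarrow> ('a \<Rightarrow> 'a tensor3) \<Rightarrow> bool" where
  "corresponds_to_bialgebra s dbr br \<Delta> \<longleftrightarrow>
     double_construction_bialgebra s br \<Delta> \<and>
     manin_triple (dscale s) (double_space s) dbr form_plus (UNIV \<times> {0}) ({0} \<times> dual_space s) \<and>
     (\<forall>X\<in>double_space s. \<forall>Y\<in>double_space s. \<forall>Z\<in>double_space s.
        dbr X Y Z = manin_bracket s br \<Delta> X Y Z)"

section \<open>Bases and tables of products\<close>

definition basis4 :: "(complex \<Rightarrow> 'a::ab_group_add \<Rightarrow> 'a) \<Rightarrow> (nat \<Rightarrow> 'a) \<Rightarrow> bool" where
  "basis4 s e \<longleftrightarrow> inj_on e {1..4} \<and> \<not> module.dependent s (e ` {1..4}) \<and>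
     module.span s (e ` {1..4}) = UNIV"

definition dual_basis ::
  "(complex \<Rightarrow> 'a::ab_group_add \<Rightarrow> 'a) \<Rightarrow> (nat \<Rightarrow> 'a) \<Rightarrow> nat \<Rightarrow> ('a \<Rightarrow> complex)" where
  "dual_basis s e i = (\<lambda>x. module.representation s (e ` {1..4}) x (e i))"

text \<open>The members of the basis of the double coming from \<open>e\<^sub>i\<close> and from \<open>e\<^sub>i\<^sup>*\<close>.\<close>

definition dE :: "(nat \<Rightarrow> 'a) \<Rightarrow> nat \<Rightarrow> 'a \<times> ('a \<Rightarrow> complex)" where
  "dE e i = (e i, 0)"

definition dF ::
  "(complex \<Rightarrow> 'a::ab_group_add \<Rightarrow> 'a) \<Rightarrow> (nat \<Rightarrow> 'a) \<Rightarrow> nat \<Rightarrow> 'a \<times> ('a \<Rightarrow> complex)" where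
  "dF s e i = (0, dual_basis s e i)"

definition double_basis ::
  "(complex \<Rightarrow> 'a::ab_group_add \<Rightarrow> 'a) \<Rightarrow> (nat \<Rightarrow> 'a) \<Rightarrow> ('a \<times> ('a \<Rightarrow> complex)) set" where
  "double_basis s e = dE e ` {1..4} \<union> dF s e ` {1..4}"

text \<open>
  An entry \<open>(u, v, w, r)\<close> of the table \<open>T\<close> stands for \<open>[u, v, w] = r\<close>. Up to skew-symmetry, the
  products of elements of the basis \<open>S\<close> are those in \<open>T\<close>, and all others vanish. For a
  trilinear skew-symmetric bracket on the span of \<open>S\<close>, this determines the bracket.
\<close>

definition has_products ::
  "'v::ab_group_add set \<Rightarrow> ('v \<times> 'v \<times> 'v \<times> 'v) list \<Rightarrow> ('v \<Rightarrow> 'v \<Rightarrow> 'v \<Rightarrow> 'v) \<Rightarrow> bool" where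
  "has_products S T br \<longleftrightarrow>
     (\<forall>(u, v, w, r)\<in>set T. br u v w = r) \<and>
     (\<forall>u\<in>S. \<forall>v\<in>S. \<forall>w\<in>S.
        (\<forall>(u', v', w', r)\<in>set T. {u', v', w'} \<noteq> {u, v, w}) \<longrightarrow> br u v w = 0)"

section \<open>The four families of bialgebras\<close>

text \<open>
  The following predicates prescribe \<open>br\<close> and \<open>\<Delta>\<close> on basis elements; multilinearity, which
  is part of \<^const>\<open>double_construction_bialgebra\<close>, then determines both maps.
\<close>

definition bialgebra_B1 ::
  "(complex \<Rightarrow> 'a::ab_group_add \<Rightarrow> 'a) \<Rightarrow> (nat \<Rightarrow> 'a) \<Rightarrow> complex \<Rightarrow>
     ('a \<Rightarrow> 'a \<Rightarrow> 'a \<Rightarrow> 'a) \<Rightarrow> ('a \<Rightarrow> 'a tensor3) \<Rightarrow> bool" where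
  "bialgebra_B1 s e k br \<Delta> \<longleftrightarrow>
     has_products (e ` {1..4})
       [(e 1, e 2, e 3, e 4), (e 1, e 2, e 4, e 3), (e 1, e 3, e 4, e 2), (e 2, e 3, e 4, e 1)] br \<and>
     \<Delta> (e 1) = tscale k (wedge3 s (e 2) (e 3) (e 4)) \<and>
     \<Delta> (e 2) = tscale k (wedge3 s (e 1) (e 3) (e 4)) \<and>
     \<Delta> (e 3) = tscale k (wedge3 s (e 1) (e 2) (e 4)) \<and>
     \<Delta> (e 4) = tscale k (wedge3 s (e 1) (e 2) (e 3))"

definition bialgebra_B2 ::
  "(complex \<Rightarrow> 'a::ab_group_add \<Rightarrow> 'a) \<Rightarrow> (nat \<Rightarrow> 'a) \<Rightarrow>
     complex \<Rightarrow> complex \<Rightarrow> complex \<Rightarrow> complex \<Rightarrow> complex \<Rightarrow> complex \<Rightarrow>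
     ('a \<Rightarrow> 'a \<Rightarrow> 'a \<Rightarrow> 'a) \<Rightarrow> ('a \<Rightarrow> 'a tensor3) \<Rightarrow> bool" where
  "bialgebra_B2 s e k1 k2 k3 c1 c2 c3 br \<Delta> \<longleftrightarrow>
     has_products (e ` {1..4}) [(e 2, e 3, e 4, e 1)] br \<and>
     \<Delta> (e 1) = 0 \<and>
     \<Delta> (e 2) = tscale k1 (wedge3 s (e 1) (e 2) (e 3)) + tscale k2 (wedge3 s (e 1) (e 2) (e 4))
              + tscale c1 (wedge3 s (e 1) (e 3) (e 4)) \<and>
     \<Delta> (e 3) = tscale k3 (wedge3 s (e 1) (e 2) (e 3)) - tscale k2 (wedge3 s (e 1) (e 3) (e 4))
              + tscale c2 (wedge3 s (e 1) (e 2) (e 4)) \<and>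
     \<Delta> (e 4) = - tscale k3 (wedge3 s (e 1) (e 2) (e 4)) + tscale k1 (wedge3 s (e 1) (e 3) (e 4))
              + tscale c3 (wedge3 s (e 1) (e 2) (e 3))"

definition bialgebra_B3 ::
  "(complex \<Rightarrow> 'a::ab_group_add \<Rightarrow> 'a) \<Rightarrow> (nat \<Rightarrow> 'a) \<Rightarrow> complex \<Rightarrow> complex \<Rightarrow> complex \<Rightarrow>
     ('a \<Rightarrow> 'a \<Rightarrow> 'a \<Rightarrow> 'a) \<Rightarrow> ('a \<Rightarrow> 'a tensor3) \<Rightarrow> bool" where
  "bialgebra_B3 s e k c1 c2 br \<Delta> \<longleftrightarrow>
     has_products (e ` {1..4}) [(e 2, e 3, e 4, e 1), (e 1, e 3, e 4, e 2)] br \<and>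
     \<Delta> (e 1) = 0 \<and> \<Delta> (e 2) = 0 \<and>
     \<Delta> (e 3) = tscale k (wedge3 s (e 1) (e 2) (e 3)) + tscale c1 (wedge3 s (e 1) (e 2) (e 4)) \<and>
     \<Delta> (e 4) = - tscale k (wedge3 s (e 1) (e 2) (e 4)) + tscale c2 (wedge3 s (e 1) (e 2) (e 3))"

definition bialgebra_B4 ::
  "(complex \<Rightarrow> 'a::ab_group_add \<Rightarrow> 'a) \<Rightarrow> (nat \<Rightarrow> 'a) \<Rightarrow> complex \<Rightarrow>
     ('a \<Rightarrow> 'a \<Rightarrow> 'a \<Rightarrow> 'a) \<Rightarrow> ('a \<Rightarrow> 'a tensor3) \<Rightarrow> bool" where
  "bialgebra_B4 s e c br \<Delta> \<longleftrightarrow>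
     has_products (e ` {1..4})
       [(e 1, e 2, e 4, e 3), (e 1, e 3, e 4, e 2), (e 2, e 3, e 4, e 1)] br \<and>
     \<Delta> (e 1) = 0 \<and> \<Delta> (e 2) = 0 \<and> \<Delta> (e 3) = 0 \<and>
     \<Delta> (e 4) = tscale c (wedge3 s (e 1) (e 2) (e 3))"

section \<open>The product tables on the double\<close>

text \<open>
  Below, \<open>E i\<close> stands for \<open>e\<^sub>i\<close> and \<open>F i\<close> for \<open>e\<^sub>i\<^sup>*\<close>.

  In the first table the mixed products are often abbreviated to
  \<open>[e\<^sub>i, e\<^sub>j, e\<^sub>k\<^sup>*] = e\<^sub>m\<^sup>*\<close> and \<open>[e\<^sub>i, e\<^sub>j\<^sup>*, e\<^sub>k\<^sup>*] = e\<^sub>m\<^sup>*\<close>. Read literally this violates the invariance of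
  the form, e.g. \<open>([e\<^sub>1, e\<^sub>2, e\<^sub>3\<^sup>*], e\<^sub>4) + ([e\<^sub>1, e\<^sub>2, e\<^sub>4], e\<^sub>3\<^sup>*) = 2\<close>. The table has the products that
  invariance forces: \<open>\<plusminus>e\<^sub>m\<^sup>*\<close> and \<open>\<plusminus>k e\<^sub>m\<close>, for all distinct \<open>i\<close>, \<open>j\<close>, \<open>k\<close>, \<open>m\<close>.
\<close>

definition products_1 ::
  "(complex \<Rightarrow> 'v::ab_group_add \<Rightarrow> 'v) \<Rightarrow> (nat \<Rightarrow> 'v) \<Rightarrow> (nat \<Rightarrow> 'v) \<Rightarrow>
     complex \<Rightarrow> ('v \<times> 'v \<times> 'v \<times> 'v) list" where
  "products_1 s E F k =
    [(E 1, E 2, E 3, E 4), (E 1, E 2, E 4, E 3), (E 1, E 3, E 4, E 2), (E 2, E 3, E 4, E 1),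
     (F 1, F 2, F 3, s k (F 4)), (F 1, F 2, F 4, s k (F 3)),
     (F 1, F 3, F 4, s k (F 2)), (F 2, F 3, F 4, s k (F 1)),
     (E 1, E 2, F 3, - F 4), (E 1, E 2, F 4, - F 3), (E 1, E 3, F 2, - F 4), (E 1, E 3, F 4, F 2),
     (E 1, E 4, F 2, F 3), (E 1, E 4, F 3, F 2), (E 2, E 3, F 1, - F 4), (E 2, E 3, F 4, - F 1),
     (E 2, E 4, F 1, F 3), (E 2, E 4, F 3, - F 1), (E 3, E 4, F 1, - F 2), (E 3, E 4, F 2, - F 1),
     (E 1, F 2, F 3, - s k (E 4)), (E 1, F 2, F 4, s k (E 3)), (E 1, F 3, F 4, - s k (E 2)),
     (E 2, F 1, F 3, - s k (E 4)), (E 2, F 1, F 4, s k (E 3)), (E 2, F 3, F 4, - s k (E 1)),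
     (E 3, F 1, F 2, - s k (E 4)), (E 3, F 1, F 4, s k (E 2)), (E 3, F 2, F 4, - s k (E 1)),
     (E 4, F 1, F 2, - s k (E 3)), (E 4, F 1, F 3, s k (E 2)), (E 4, F 2, F 3, - s k (E 1))]"

text \<open>
  With \<open>[e\<^sub>2, e\<^sub>3, e\<^sub>4] = e\<^sub>1\<close> the only product of \<open>A\<close>, invariance forces
  \<open>[e\<^sub>2, e\<^sub>3, e\<^sub>1\<^sup>*] = -e\<^sub>4\<^sup>*\<close>, \<open>[e\<^sub>2, e\<^sub>4, e\<^sub>1\<^sup>*] = e\<^sub>3\<^sup>*\<close>, \<open>[e\<^sub>3, e\<^sub>4, e\<^sub>1\<^sup>*] = -e\<^sub>2\<^sup>*\<close>. Some sources print these with
  every index \<open>2, 3, 4\<close> lowered by one, which is incompatible with \<open>[e\<^sub>2, e\<^sub>3, e\<^sub>4] = e\<^sub>1\<close>.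
\<close>

definition products_2 ::
  "(complex \<Rightarrow> 'v::ab_group_add \<Rightarrow> 'v) \<Rightarrow> (nat \<Rightarrow> 'v) \<Rightarrow> (nat \<Rightarrow> 'v) \<Rightarrow>
     complex \<Rightarrow> complex \<Rightarrow> complex \<Rightarrow> complex \<Rightarrow> complex \<Rightarrow> complex \<Rightarrow> ('v \<times> 'v \<times> 'v \<times> 'v) list" where
  "products_2 s E F k1 k2 k3 c1 c2 c3 =
    [(E 2, E 3, E 4, E 1),
     (F 1, F 2, F 3, s k1 (F 2) + s k3 (F 3) + s c3 (F 4)),
     (F 1, F 2, F 4, s k2 (F 2) + s c2 (F 3) - s k3 (F 4)),
     (F 1, F 3, F 4, s c1 (F 2) - s k2 (F 3) + s k1 (F 4)),
     (E 2, E 3, F 1, - F 4), (E 2, E 4, F 1, F 3), (E 3, E 4, F 1, - F 2),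
     (E 2, F 1, F 2, - s k1 (E 3) - s k2 (E 4)), (E 2, F 2, F 3, - s k1 (E 1)),
     (E 2, F 1, F 3, s k1 (E 2) - s c1 (E 4)), (E 2, F 2, F 4, - s k2 (E 1)),
     (E 2, F 1, F 4, s k2 (E 2) + s c1 (E 3)), (E 2, F 3, F 4, - s c1 (E 1)),
     (E 3, F 1, F 2, - s k3 (E 3) - s c2 (E 4)), (E 3, F 2, F 3, - s k3 (E 1)),
     (E 3, F 1, F 3, s k3 (E 2) + s k2 (E 4)), (E 3, F 2, F 4, - s c2 (E 1)),
     (E 3, F 1, F 4, s c2 (E 2) - s k2 (E 3)), (E 3, F 3, F 4, s k2 (E 1)),
     (E 4, F 1, F 2, - s c3 (E 3) + s k3 (E 4)), (E 4, F 2, F 3, - s c3 (E 1)),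
     (E 4, F 1, F 3, s c3 (E 2) - s k1 (E 4)), (E 4, F 2, F 4, s k3 (E 1)),
     (E 4, F 1, F 4, - s k3 (E 2) + s k1 (E 3)), (E 4, F 3, F 4, - s k1 (E 1))]"

definition products_3 ::
  "(complex \<Rightarrow> 'v::ab_group_add \<Rightarrow> 'v) \<Rightarrow> (nat \<Rightarrow> 'v) \<Rightarrow> (nat \<Rightarrow> 'v) \<Rightarrow>
     complex \<Rightarrow> complex \<Rightarrow> complex \<Rightarrow> ('v \<times> 'v \<times> 'v \<times> 'v) list" where
  "products_3 s E F k c1 c2 =
    [(E 2, E 3, E 4, E 1), (E 1, E 3, E 4, E 2),
     (F 1, F 2, F 3, s k (F 3) + s c2 (F 4)), (F 1, F 2, F 4, s c1 (F 3) - s k (F 4)),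
     (E 2, E 3, F 1, - F 4), (E 3, E 4, F 1, - F 2), (E 2, E 4, F 1, F 3),
     (E 1, E 4, F 2, F 3), (E 1, E 3, F 2, - F 4), (E 3, E 4, F 2, - F 1),
     (E 3, F 1, F 2, - s k (E 3) - s c1 (E 4)), (E 4, F 1, F 2, - s c2 (E 3) + s k (E 4)),
     (E 3, F 1, F 3, s k (E 2)), (E 4, F 1, F 3, s c2 (E 2)), (E 3, F 1, F 4, s c1 (E 2)),
     (E 4, F 1, F 4, - s k (E 2)), (E 3, F 2, F 3, - s k (E 1)), (E 4, F 2, F 3, - s c2 (E 1)),
     (E 3, F 2, F 4, - s c1 (E 1)), (E 4, F 2, F 4, s k (E 1))]"

definition products_4 ::
  "(complex \<Rightarrow> 'v::ab_group_add \<Rightarrow> 'v) \<Rightarrow> (nat \<Rightarrow> 'v) \<Rightarrow> (nat \<Rightarrow> 'v) \<Rightarrow>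
     complex \<Rightarrow> ('v \<times> 'v \<times> 'v \<times> 'v) list" where
  "products_4 s E F c =
    [(E 1, E 2, E 4, E 3), (E 1, E 3, E 4, E 2), (E 2, E 3, E 4, E 1), (F 1, F 2, F 3, s c (F 4)),
     (E 1, E 3, F 2, - F 4), (E 1, E 2, F 3, - F 4), (E 1, E 4, F 2, F 3), (E 1, E 4, F 3, F 2),
     (E 2, E 3, F 1, - F 4), (E 2, E 4, F 1, F 3), (E 2, E 4, F 3, - F 1),
     (E 3, E 4, F 2, - F 1), (E 3, E 4, F 1, - F 2),
     (E 4, F 1, F 2, - s c (E 3)), (E 4, F 1, F 3, s c (E 2)), (E 4, F 2, F 3, - s c (E 1))]"

end

(* Identify A with C^4 by the basis e, and A* with C^4 by the dual basis. In terms of the ternary cross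
   product of C^4, given by det(x, y, z, w) = (x * y * z) . w, all four bialgebras have the shape
   [x, y, z] = S (x * y * z), [xi, eta, zeta]^* = T (xi * eta * zeta), Delta x = det(-, -, -, T x)
   with symmetric matrices S, T satisfying S T = T S = l I (l = k for B_1 and l = 0 otherwise). The
   bracket of the double is then
     S (x * y * z) + xi * eta * T z + eta * gamma * T x + gamma * xi * T y
       + x * y * S gamma + y * z * S xi + z * x * S eta + T (xi * eta * gamma),
   symmetric under exchanging (A, S) with (A*, T). The fundamental identity splits by the types of
   the arguments. If it involves only S (or only T), it says that the operator z |-> S (x * y * z),
   being traceless, acts as a derivation. In the mixed cases the iterated cross product of vectors
   and forms expands into pairings, and S T = l I makes the terms cancel. *)

theory Submission
  imports Defs "HOL-Analysis.Determinants"
begin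

section \<open>The ternary cross product\<close>

definition dot4 :: "complex^4 \<Rightarrow> complex^4 \<Rightarrow> complex" where
  "dot4 x y = x$1 * y$1 + x$2 * y$2 + x$3 * y$3 + x$4 * y$4"

text \<open>The 3 x 3 minor in columns \<open>i\<close>, \<open>j\<close>, \<open>k\<close> of the
  matrix with rows \<open>x\<close>, \<open>y\<close>, \<open>z\<close>, written out so that cross
  product identities become polynomial identities in the entries.\<close>

definition minor3 :: "4 \<Rightarrow> 4 \<Rightarrow> 4 \<Rightarrow> complex^4 \<Rightarrow> complex^4 \<Rightarrow> complex^4 \<Rightarrow> complex" where
  "minor3 i j k x y z =
     x$i * y$j * z$k + x$j * y$k * z$i + x$k * y$i * z$j
     - x$j * y$i * z$k - x$i * y$k * z$j - x$k * y$j * z$i"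

text \<open>Polymorphic, so that the same constructor builds vectors from scalars and matrices from
  rows.\<close>

definition vec4 :: "'b \<Rightarrow> 'b \<Rightarrow> 'b \<Rightarrow> 'b \<Rightarrow> 'b^4" where
  "vec4 a b c d = (\<chi> i. if i = 1 then a else if i = 2 then b else if i = 3 then c else d)"

lemma vec4_nth [simp]:
  "vec4 a b c d $ 1 = a" "vec4 a b c d $ 2 = b" "vec4 a b c d $ 3 = c" "vec4 a b c d $ 4 = d"
  by (simp_all add: vec4_def)

text \<open>The signs are those of cofactor expansion along the last row, so
  \<open>dot4 (cross4 x y z) w\<close> is the determinant with rows \<open>x\<close>,
  \<open>y\<close>, \<open>z\<close>, \<open>w\<close>.\<close>

definition cross4 :: "complex^4 \<Rightarrow> complex^4 \<Rightarrow> complex^4 \<Rightarrow> complex^4" where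
  "cross4 x y z =
     vec4 (- minor3 2 3 4 x y z) (minor3 1 3 4 x y z) (- minor3 1 2 4 x y z) (minor3 1 2 3 x y z)"

lemma cross4_nth:
  "cross4 x y z $ 1 = - minor3 2 3 4 x y z" "cross4 x y z $ 2 = minor3 1 3 4 x y z"
  "cross4 x y z $ 3 = - minor3 1 2 4 x y z" "cross4 x y z $ 4 = minor3 1 2 3 x y z"
  by (simp_all add: cross4_def)

lemma vec4_eq_iff: "x = y \<longleftrightarrow> x$1 = y$1 \<and> x$2 = y$2 \<and> x$3 = y$3 \<and> x$4 = y$4" for x y :: "'b^4"
  by (simp add: vec_eq_iff forall_4)

lemmas cross4_simps = vec4_eq_iff cross4_nth minor3_def

lemma cross4_add:
  "cross4 (x + x') y z = cross4 x y z + cross4 x' y z"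
  "cross4 y (x + x') z = cross4 y x z + cross4 y x' z"
  "cross4 y z (x + x') = cross4 y z x + cross4 y z x'"
  by (simp_all add: cross4_simps algebra_simps)

lemma cross4_scale:
  "cross4 (c *s x) y z = c *s cross4 x y z"
  "cross4 x (c *s y) z = c *s cross4 x y z"
  "cross4 x y (c *s z) = c *s cross4 x y z"
  by (simp_all add: cross4_simps algebra_simps)

lemma cross4_zero [simp]: "cross4 0 y z = 0" "cross4 y 0 z = 0" "cross4 y z 0 = 0"
  by (simp_all add: cross4_simps)

lemma cross4_minus [simp]:
  "cross4 (- x) y z = - cross4 x y z" "cross4 y (- x) z = - cross4 y x z"
  "cross4 y z (- x) = - cross4 y z x"
  by (simp_all add: cross4_simps)

lemma cross4_swap: "cross4 y x z = - cross4 x y z" "cross4 x z y = - cross4 x y z"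
  by (simp_all add: cross4_simps)

lemma cross4_rotate: "cross4 x y z = cross4 y z x"
  by (metis cross4_swap minus_minus)

section \<open>The pairing and iterated cross products\<close>

lemma dot4_commute: "dot4 x y = dot4 y x"
  by (simp add: dot4_def mult.commute)

lemma dot4_scale [simp]: "dot4 (c *s x) y = c * dot4 x y" "dot4 x (c *s y) = c * dot4 x y"
  by (simp_all add: dot4_def algebra_simps)

text \<open>Two rows of a determinant are exchanged. This adjointness computes both coadjoint
  actions.\<close>

lemma dot4_cross4_swap: "dot4 (cross4 x y z) w = - dot4 (cross4 x y w) z"
  by (simp add: dot4_def cross4_nth minor3_def algebra_simps)

text \<open>The analogue of the vector triple product: dualising twice returns to the trivector on
  \<open>x\<close>, \<open>y\<close>, \<open>p\<close>, and contracting it with \<open>g\<close> and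
  \<open>b\<close> leaves a combination of the three vectors whose coefficients are 2 x 2 minors of
  pairings.\<close>

lemma cross4_cross4:
  "cross4 (cross4 x y p) g b =
     (dot4 g x * dot4 b p - dot4 g p * dot4 b x) *s y
     - (dot4 g y * dot4 b p - dot4 g p * dot4 b y) *s x
     - (dot4 g x * dot4 b y - dot4 g y * dot4 b x) *s p"
  by (simp add: cross4_simps dot4_def algebra_simps)

lemma mult_vec4_nth: "(S *v x) $ i = S$i$1 * x$1 + S$i$2 * x$2 + S$i$3 * x$3 + S$i$4 * x$4"
  for S :: "complex^4^4"
  by (simp add: matrix_vector_mult_def sum_4)

lemma dot4_symmetric:
  fixes S :: "complex^4^4"
  assumes "transpose S = S"
  shows "dot4 (S *v x) y = dot4 x (S *v y)"
proof -
  have "S$i$j = S$j$i" for i j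
    using arg_cong[OF assms, of "\<lambda>A. A $ j $ i"] by (simp add: transpose_def)
  note s = this[of 2 1] this[of 3 1] this[of 4 1] this[of 3 2] this[of 4 2] this[of 4 3]
  show ?thesis by (simp add: dot4_def mult_vec4_nth s algebra_simps)
qed

text \<open>Applying \<open>D\<close> to one row of a determinant at a time and summing multiplies
  the determinant by the trace. Here the last row is a free vector; the term with \<open>D\<close>
  on it has been moved to the right, where it becomes the transpose.\<close>

lemma cross4_derivation:
  fixes D :: "complex^4^4"
  shows "cross4 (D *v a) b c + cross4 a (D *v b) c + cross4 a b (D *v c) =
    trace D *s cross4 a b c - transpose D *v cross4 a b c"
  by (simp add: cross4_simps mult_vec4_nth trace_def sum_4 transpose_def algebra_simps)

definition cross4_matrix :: "complex^4 \<Rightarrow> complex^4 \<Rightarrow> complex^4^4" where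
  "cross4_matrix x y = (\<chi> i j. cross4 x y (axis j 1) $ i)"

lemma cross4_matrix_mult: "cross4_matrix x y *v z = cross4 x y z"
  by (simp add: cross4_matrix_def vec4_eq_iff mult_vec4_nth cross4_nth minor3_def axis_def algebra_simps)

text \<open>Reflects the skewness of the determinant in its last two rows.\<close>

lemma transpose_cross4_matrix: "transpose (cross4_matrix x y) = - cross4_matrix x y"
  by (simp add: cross4_matrix_def transpose_def vec_eq_iff forall_4 cross4_nth minor3_def axis_def)

text \<open>The operator \<open>z \<mapsto> S (x \<times> y \<times> z)\<close> is a product of a symmetric and a skew matrix, hence traceless.\<close>

lemma cross4_symmetric_derivation:
  fixes S :: "complex^4^4"
  assumes "transpose S = S"
  shows "cross4 x y (S *v cross4 a b c) = cross4 (S *v cross4 x y a) b c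
    + cross4 a (S *v cross4 x y b) c + cross4 a b (S *v cross4 x y c)"
proof -
  let ?W = "cross4_matrix x y"
  have t: "transpose (S ** ?W) = - (?W ** S)"
    unfolding matrix_transpose_mul transpose_cross4_matrix assms
    by (simp add: vec_eq_iff matrix_matrix_mult_def sum_4)
  have "trace (S ** ?W) = trace (transpose (S ** ?W))" by (simp add: trace_def transpose_def)
  also have "\<dots> = - trace (?W ** S)" unfolding t by (simp add: trace_def sum_4)
  also have "\<dots> = - trace (S ** ?W)" by (simp only: trace_mul_sym[of ?W S])
  finally have "trace (S ** ?W) = 0" by simp
  moreover have "(- (?W ** S)) *v v = - cross4 x y (S *v v)" for v
    using matrix_vector_mult_diff_rdistrib[of 0 "?W ** S" v]
    by (simp add: cross4_matrix_mult flip: matrix_vector_mul_assoc)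
  \<comment> \<open>For \<open>D = S ** ?W\<close> the trace term of
    \<open>cross4_derivation\<close> drops out, and minus the transpose of \<open>D\<close> is
    \<open>?W ** S\<close>, which puts \<open>S\<close> inside the cross product.\<close>
  ultimately show ?thesis
    using cross4_derivation[of "S ** ?W" a b c]
    by (simp add: t cross4_matrix_mult flip: matrix_vector_mul_assoc)
qed

section \<open>The model of the double\<close>

locale symmetric_pair =
  fixes S T :: "complex^4^4" and l :: complex
  assumes S_sym: "transpose S = S" and T_sym: "transpose T = T"
    and ST: "S *v (T *v x) = l *s x" and TS: "T *v (S *v x) = l *s x"
begin

lemma dot4_ST: "dot4 (S *v x) (T *v y) = l * dot4 x y" "dot4 (T *v x) (S *v y) = l * dot4 x y"
  by (simp_all add: dot4_symmetric[OF S_sym] dot4_symmetric[OF T_sym] ST TS)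

lemma dot4_S_swap: "dot4 x (S *v y) = dot4 y (S *v x)"
  by (metis dot4_symmetric[OF S_sym] dot4_commute)

lemma dot4_T_swap: "dot4 x (T *v y) = dot4 y (T *v x)"
  by (metis dot4_symmetric[OF T_sym] dot4_commute)

text \<open>
  In the names, \<open>A\<close> stands for a vector and \<open>F\<close> for a form among the arguments of
  \<open>[x\<^sub>1, x\<^sub>2, [x\<^sub>3, x\<^sub>4, x\<^sub>5]]\<close>.
\<close>

lemma ad_AA_AFF:
  "S *v cross4 x y (cross4 \<eta> \<gamma> (T *v a)) = l *s cross4 \<eta> \<gamma> (cross4 x y a)
    + cross4 (cross4 x y (S *v \<eta>)) \<gamma> (T *v a) + cross4 \<eta> (cross4 x y (S *v \<gamma>)) (T *v a)"
proof -
  \<comment> \<open>Cyclic rotations bring every iterated product to the shape of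
    \<open>cross4_cross4\<close>, with the inner product in the first slot.\<close>
  have r: "cross4 x y (cross4 \<eta> \<gamma> (T *v a)) = cross4 (cross4 \<eta> \<gamma> (T *v a)) x y"
    "cross4 \<eta> \<gamma> (cross4 x y a) = cross4 (cross4 x y a) \<eta> \<gamma>"
    "cross4 \<eta> (cross4 x y (S *v \<gamma>)) (T *v a) = cross4 (cross4 x y (S *v \<gamma>)) (T *v a) \<eta>"
    by (metis cross4_rotate)+
  have c: "dot4 x \<gamma> = dot4 \<gamma> x" "dot4 x \<eta> = dot4 \<eta> x" "dot4 y \<gamma> = dot4 \<gamma> y" "dot4 y \<eta> = dot4 \<eta> y"
    "dot4 x (T *v a) = dot4 (T *v a) x" "dot4 y (T *v a) = dot4 (T *v a) y"
    "dot4 a \<gamma> = dot4 \<gamma> a" "dot4 a \<eta> = dot4 \<eta> a" "dot4 \<eta> (S *v \<gamma>) = dot4 \<gamma> (S *v \<eta>)"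
    by (rule dot4_commute dot4_S_swap)+
  show ?thesis
    unfolding r cross4_cross4
    by (simp add: c dot4_ST ST matrix_vector_mult_diff_distrib matrix_vector_right_distrib
        vector_scalar_commute vec4_eq_iff algebra_simps)
qed

text \<open>After expansion, the coefficients of \<open>T *v x\<close> and \<open>T *v y\<close>
  cancel by the symmetry of \<open>S\<close>, and \<open>T S = l I\<close> turns the rest into the
  left side. Besides a case of the fundamental identity, this gives both compatibility conditions on
  the coproduct.\<close>

lemma ad_AA_FFF:
  "l *s cross4 x y (cross4 \<eta> \<gamma> \<zeta>) = T *v (cross4 (cross4 x y (S *v \<eta>)) \<gamma> \<zeta>
    + cross4 \<eta> (cross4 x y (S *v \<gamma>)) \<zeta> + cross4 \<eta> \<gamma> (cross4 x y (S *v \<zeta>)))"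
proof -
  have r: "cross4 x y (cross4 \<eta> \<gamma> \<zeta>) = cross4 (cross4 \<eta> \<gamma> \<zeta>) x y"
    "cross4 \<eta> \<gamma> (cross4 x y (S *v \<zeta>)) = cross4 (cross4 x y (S *v \<zeta>)) \<eta> \<gamma>"
    "cross4 \<eta> (cross4 x y (S *v \<gamma>)) \<zeta> = cross4 (cross4 x y (S *v \<gamma>)) \<zeta> \<eta>"
    by (metis cross4_rotate)+
  have c: "dot4 x \<gamma> = dot4 \<gamma> x" "dot4 x \<eta> = dot4 \<eta> x" "dot4 y \<gamma> = dot4 \<gamma> y" "dot4 y \<eta> = dot4 \<eta> y"
    "dot4 x \<zeta> = dot4 \<zeta> x" "dot4 y \<zeta> = dot4 \<zeta> y"
    "dot4 \<eta> (S *v \<gamma>) = dot4 \<gamma> (S *v \<eta>)" "dot4 \<eta> (S *v \<zeta>) = dot4 \<zeta> (S *v \<eta>)"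
    "dot4 \<gamma> (S *v \<zeta>) = dot4 \<zeta> (S *v \<gamma>)"
    by (rule dot4_commute dot4_S_swap)+
  show ?thesis
    unfolding r cross4_cross4
    by (simp add: c TS matrix_vector_mult_diff_distrib matrix_vector_right_distrib
        vector_scalar_commute vec4_eq_iff algebra_simps)
qed

text \<open>The vectors \<open>a\<close> and \<open>b\<close> meet the acting vector
  \<open>x\<close> through \<open>T\<close>, and the two forms meet through \<open>S\<close>, so the
  cancellation uses the symmetry of both matrices.\<close>

lemma ad_AF_AAF:
  "cross4 \<eta> (cross4 a b (S *v \<gamma>)) (T *v x) = cross4 (cross4 x a (S *v \<eta>)) \<gamma> (T *v b)
    - cross4 (cross4 x b (S *v \<eta>)) \<gamma> (T *v a) + S *v cross4 a b (cross4 \<eta> \<gamma> (T *v x))"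
proof -
  have r: "cross4 \<eta> (cross4 a b (S *v \<gamma>)) (T *v x) = cross4 (cross4 a b (S *v \<gamma>)) (T *v x) \<eta>"
    "cross4 a b (cross4 \<eta> \<gamma> (T *v x)) = cross4 (cross4 \<eta> \<gamma> (T *v x)) a b"
    by (metis cross4_rotate)+
  have c: "dot4 a \<gamma> = dot4 \<gamma> a" "dot4 b \<gamma> = dot4 \<gamma> b" "dot4 a \<eta> = dot4 \<eta> a" "dot4 b \<eta> = dot4 \<eta> b"
    "dot4 \<eta> x = dot4 x \<eta>" "dot4 \<gamma> x = dot4 x \<gamma>"
    "dot4 (T *v a) x = dot4 a (T *v x)" "dot4 (T *v b) x = dot4 b (T *v x)"
    "dot4 (T *v x) a = dot4 a (T *v x)" "dot4 (T *v x) b = dot4 b (T *v x)"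
    "dot4 (T *v b) a = dot4 (T *v a) b"
    "dot4 \<eta> (S *v \<gamma>) = dot4 \<gamma> (S *v \<eta>)"
    using dot4_S_swap dot4_T_swap dot4_commute by metis+
  show ?thesis
    unfolding r cross4_cross4
    by (simp add: c dot4_ST ST matrix_vector_mult_diff_distrib matrix_vector_right_distrib
        vector_scalar_commute vec4_eq_iff algebra_simps)
qed

end

section \<open>The bracket and the form in coordinates\<close>

type_synonym model = "(complex^4) \<times> (complex^4)"

definition mbracket :: "complex^4^4 \<Rightarrow> complex^4^4 \<Rightarrow> model \<Rightarrow> model \<Rightarrow> model \<Rightarrow> model" where
  "mbracket S T = (\<lambda>(x, \<xi>) (y, \<eta>) (z, \<gamma>).
     (S *v cross4 x y z + cross4 \<xi> \<eta> (T *v z) + cross4 \<eta> \<gamma> (T *v x) + cross4 \<gamma> \<xi> (T *v y),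
      cross4 x y (S *v \<gamma>) + cross4 y z (S *v \<xi>) + cross4 z x (S *v \<eta>) + T *v cross4 \<xi> \<eta> \<gamma>))"

definition mform :: "model \<Rightarrow> model \<Rightarrow> complex" where
  "mform X Y = dot4 (fst X) (snd Y) + dot4 (snd X) (fst Y)"

definition mscale :: "complex \<Rightarrow> model \<Rightarrow> model" where
  "mscale c X = (c *s fst X, c *s snd X)"

lemma mult_vec_minus [simp]: "S *v (- x) = - (S *v x)" for S :: "complex^4^4"
  by (simp add: vec4_eq_iff mult_vec4_nth)

lemma mbracket_swap:
  "mbracket S T Y X Z = - mbracket S T X Y Z"
  "mbracket S T X Z Y = - mbracket S T X Y Z"
proof -
  obtain x \<xi> y \<eta> z \<gamma> where "X = (x, \<xi>)" "Y = (y, \<eta>)" "Z = (z, \<gamma>)" by (metis surj_pair)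
  note e = this
  show "mbracket S T Y X Z = - mbracket S T X Y Z"
    unfolding e mbracket_def by (simp add: cross4_swap(1)[of y x] cross4_swap(1)[of \<eta> \<xi>]
      cross4_swap(1)[of z x] cross4_swap(1)[of \<gamma> \<xi>] cross4_swap(1)[of z y] cross4_swap(1)[of \<gamma> \<eta>])
  show "mbracket S T X Z Y = - mbracket S T X Y Z"
    unfolding e mbracket_def by (simp add: cross4_swap(2)[of x z y] cross4_swap(2)[of \<xi> \<gamma> \<eta>]
      cross4_swap(1)[of y x] cross4_swap(1)[of \<eta> \<xi>]
      cross4_swap(1)[of z x] cross4_swap(1)[of \<gamma> \<xi>] cross4_swap(1)[of z y] cross4_swap(1)[of \<gamma> \<eta>])
qed

lemma mbracket_add:
  "mbracket S T (X + X') Y Z = mbracket S T X Y Z + mbracket S T X' Y Z"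
  "mbracket S T Y (X + X') Z = mbracket S T Y X Z + mbracket S T Y X' Z"
  "mbracket S T Y Z (X + X') = mbracket S T Y Z X + mbracket S T Y Z X'"
  by (simp_all add: mbracket_def split_beta cross4_add matrix_vector_right_distrib)

lemma mbracket_scale:
  "mbracket S T (mscale c X) Y Z = mscale c (mbracket S T X Y Z)"
  "mbracket S T Y (mscale c X) Z = mscale c (mbracket S T Y X Z)"
  "mbracket S T Y Z (mscale c X) = mscale c (mbracket S T Y Z X)"
  by (simp_all add: mbracket_def mscale_def split_beta cross4_scale vector_scalar_commute
      vector_add_ldistrib)

text \<open>Halves the cases of the fundamental identity: each one proved for all symmetric pairs
  also holds with vectors and forms exchanged.\<close>

lemma mbracket_dual: "mbracket T S (prod.swap X) (prod.swap Y) (prod.swap Z) = prod.swap (mbracket S T X Y Z)"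
  by (cases X; cases Y; cases Z) (simp add: mbracket_def add_ac)

section \<open>The fundamental identity as the vanishing of a multilinear defect\<close>

definition jacobiator :: "('v::ab_group_add \<Rightarrow> 'v \<Rightarrow> 'v \<Rightarrow> 'v) \<Rightarrow> 'v \<Rightarrow> 'v \<Rightarrow> 'v \<Rightarrow> 'v \<Rightarrow> 'v \<Rightarrow> 'v" where
  "jacobiator br x1 x2 x3 x4 x5 = br x1 x2 (br x3 x4 x5)
     - (br (br x1 x2 x3) x4 x5 + br x3 (br x1 x2 x4) x5 + br x3 x4 (br x1 x2 x5))"

lemma additive_minus:
  fixes f :: "'a::ab_group_add \<Rightarrow> 'b::ab_group_add"
  assumes "\<And>x y. f (x + y) = f x + f y"
  shows "f (- x) = - f x"
  using assms[of 0 0] assms[of x "- x"] by (simp add: eq_neg_iff_add_eq_0 add.commute)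

context symmetric_pair
begin

abbreviation "J \<equiv> jacobiator (mbracket S T)"

lemma mbracket_minus:
  "mbracket S T (- X) Y Z = - mbracket S T X Y Z"
  "mbracket S T Y (- X) Z = - mbracket S T Y X Z"
  "mbracket S T Y Z (- X) = - mbracket S T Y Z X"
  by (rule additive_minus, simp add: mbracket_add)+

lemma J_add:
  "J (X + X') X2 X3 X4 X5 = J X X2 X3 X4 X5 + J X' X2 X3 X4 X5"
  "J X1 (X + X') X3 X4 X5 = J X1 X X3 X4 X5 + J X1 X' X3 X4 X5"
  "J X1 X2 (X + X') X4 X5 = J X1 X2 X X4 X5 + J X1 X2 X' X4 X5"
  "J X1 X2 X3 (X + X') X5 = J X1 X2 X3 X X5 + J X1 X2 X3 X' X5"
  "J X1 X2 X3 X4 (X + X') = J X1 X2 X3 X4 X + J X1 X2 X3 X4 X'"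
  by (simp_all add: jacobiator_def mbracket_add algebra_simps)

text \<open>By additivity each argument may be taken to be a vector or a form. Skewness in the first
  two and in the last three arguments then lets vectors come first, which leaves 3 times 4
  types.\<close>

lemma J_swap:
  "J X2 X1 X3 X4 X5 = - J X1 X2 X3 X4 X5"
  "J X1 X2 X4 X3 X5 = - J X1 X2 X3 X4 X5"
  "J X1 X2 X3 X5 X4 = - J X1 X2 X3 X4 X5"
  unfolding jacobiator_def
    apply (simp add: mbracket_swap(1)[of _ _ X2 X1] mbracket_minus)
   apply (simp add: mbracket_swap(1)[of _ _ X4 X3] mbracket_minus mbracket_swap(1)[of _ _ X4 "mbracket S T X1 X2 X3"]
        mbracket_swap(1)[of _ _ "mbracket S T X1 X2 X4" X3])
  apply (simp add: mbracket_swap(2)[of _ _ _ X5 X4] mbracket_minus mbracket_swap(2)[of _ _ _ X5 "mbracket S T X1 X2 X4"]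
        mbracket_swap(2)[of _ _ _ "mbracket S T X1 X2 X5" X4])
  done

text \<open>Six of the twelve types. The first, second and fifth involve \<open>S\<close> alone and
  follow from the derivation property, in the latter two with \<open>S *v \<gamma>\<close> or
  \<open>S *v \<eta>\<close> as an argument; the other three are the mixed identities.\<close>

lemma J_primal:
  "J (x, 0) (y, 0) (a, 0) (b, 0) (c, 0) = 0"
  "J (x, 0) (y, 0) (a, 0) (b, 0) (0, \<gamma>) = 0"
  "J (x, 0) (y, 0) (a, 0) (0, \<beta>) (0, \<gamma>) = 0"
  "J (x, 0) (y, 0) (0, \<alpha>) (0, \<beta>) (0, \<gamma>) = 0"
  "J (x, 0) (0, \<eta>) (a, 0) (b, 0) (c, 0) = 0"
  "J (x, 0) (0, \<eta>) (a, 0) (b, 0) (0, \<gamma>) = 0"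
proof -
  show "J (x, 0) (y, 0) (a, 0) (b, 0) (c, 0) = 0"
    using arg_cong[OF cross4_symmetric_derivation[OF S_sym, of x y a b c], of "\<lambda>v. S *v v"]
    by (simp add: jacobiator_def mbracket_def matrix_vector_right_distrib)
  show "J (x, 0) (y, 0) (a, 0) (b, 0) (0, \<gamma>) = 0"
    using cross4_symmetric_derivation[OF S_sym, of x y a b "S *v \<gamma>"]
    by (simp add: jacobiator_def mbracket_def)
  show "J (x, 0) (y, 0) (a, 0) (0, \<beta>) (0, \<gamma>) = 0"
    using ad_AA_AFF[of x y \<beta> \<gamma> a]
    by (simp add: jacobiator_def mbracket_def TS cross4_scale)
  show "J (x, 0) (y, 0) (0, \<alpha>) (0, \<beta>) (0, \<gamma>) = 0"
    using ad_AA_FFF[of x y \<alpha> \<beta> \<gamma>]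
    by (simp add: jacobiator_def mbracket_def ST cross4_scale matrix_vector_right_distrib)
  \<comment> \<open>Rotated, the action of \<open>x\<close> and \<open>\<eta>\<close> on
    \<open>a\<close> is the cross product operator of the pair \<open>x\<close>,
    \<open>S *v \<eta>\<close>.\<close>
  have r: "cross4 a x (S *v \<eta>) = cross4 x (S *v \<eta>) a" for a
    by (rule cross4_rotate)
  show "J (x, 0) (0, \<eta>) (a, 0) (b, 0) (c, 0) = 0"
    using cross4_symmetric_derivation[OF S_sym, of x "S *v \<eta>" a b c]
    by (simp add: jacobiator_def mbracket_def r cross4_rotate[of c a]
        cross4_rotate[of "S *v cross4 x (S *v \<eta>) a" b c])
  have n: "cross4 u x v = - cross4 x u v" for u v by (rule cross4_swap)
  show "J (x, 0) (0, \<eta>) (a, 0) (b, 0) (0, \<gamma>) = 0"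
    using ad_AF_AAF[of \<eta> a b \<gamma> x]
    by (simp add: jacobiator_def mbracket_def n cross4_swap(1)[of \<gamma> "cross4 x _ _"])
qed

end

lemma jacobiator_dual:
  "jacobiator (mbracket T S) (prod.swap X1) (prod.swap X2) (prod.swap X3) (prod.swap X4) (prod.swap X5)
   = prod.swap (jacobiator (mbracket S T) X1 X2 X3 X4 X5)"
  unfolding jacobiator_def mbracket_dual by (simp add: prod_eq_iff)

context symmetric_pair
begin

lemma jacobiator_zero: "J X1 X2 X3 X4 X5 = 0"
proof -
  \<comment> \<open>exchanging vectors and forms turns the remaining six types into those of \<open>J_primal\<close>\<close>
  interpret dual: symmetric_pair T S l
    by unfold_locales (simp_all add: S_sym T_sym ST TS)
  have dual: "J (prod.swap X1) (prod.swap X2) (prod.swap X3) (prod.swap X4) (prod.swap X5) = 0"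
    if "dual.J X1 X2 X3 X4 X5 = 0" for X1 X2 X3 X4 X5
    unfolding jacobiator_dual[where S = T and T = S] that by (simp add: zero_prod_def)
  have sort: "J (0, \<xi>) (x, 0) Y1 Y2 Y3 = - J (x, 0) (0, \<xi>) Y1 Y2 Y3"
    "J Y1 Y2 (0, \<xi>) (x, 0) Y3 = - J Y1 Y2 (x, 0) (0, \<xi>) Y3"
    "J Y1 Y2 Y3 (0, \<xi>) (x, 0) = - J Y1 Y2 Y3 (x, 0) (0, \<xi>)" for \<xi> x Y1 Y2 Y3
    by (rule J_swap)+
  note d = dual.J_primal[THEN dual, unfolded swap_simp sort neg_equal_0_iff_equal]
  have e: "X = (fst X, 0) + (0, snd X)" for X :: model by (simp add: prod_eq_iff)
  show ?thesis
    \<comment> \<open>Each argument is split into its vector and its form; \<open>add_Pair\<close>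
      is disabled below because it would merge them again.\<close>
    apply (subst e[of X1], subst e[of X2], subst e[of X3], subst e[of X4], subst e[of X5])
    by (simp add: J_add sort J_primal d del: add_Pair)
qed

end

section \<open>Coordinates on the double\<close>

text \<open>Every axiom is an equation in \<open>V\<close>, so it may be checked after the injective
  map \<open>\<phi>\<close>, where \<open>mbracket\<close> satisfies it. The image of
  \<open>\<phi>\<close> is arbitrary, so this serves \<open>A\<close>, its dual, the double and the
  two halves of the double.\<close>

lemma (in symmetric_pair) three_lie_algebra_transport:
  assumes "vector_space s" "module.subspace s V" "inj_on \<phi> V"
    and add: "\<And>x y. x \<in> V \<Longrightarrow> y \<in> V \<Longrightarrow> \<phi> (x + y) = \<phi> x + \<phi> y"
    and scale: "\<And>c x. x \<in> V \<Longrightarrow> \<phi> (s c x) = mscale c (\<phi> x)"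
    and closed: "\<And>x y z. x \<in> V \<Longrightarrow> y \<in> V \<Longrightarrow> z \<in> V \<Longrightarrow> br x y z \<in> V"
    and bracket: "\<And>x y z. x \<in> V \<Longrightarrow> y \<in> V \<Longrightarrow> z \<in> V \<Longrightarrow>
      \<phi> (br x y z) = mbracket S T (\<phi> x) (\<phi> y) (\<phi> z)"
  shows "three_lie_algebra s V br"
proof -
  interpret vector_space s by fact
  note sub = subspace_add[OF assms(2)] subspace_scale[OF assms(2)] subspace_neg[OF assms(2)]
  have neg: "\<phi> (- x) = - \<phi> x" if "x \<in> V" for x
    using scale[OF that, of "-1"] by (simp add: scale_minus_left mscale_def prod_eq_iff)
  note eq = inj_onD[OF assms(3)]
  note ev = add scale neg bracket sub closed mbracket_add mbracket_scale
  have fi: "br x1 x2 (br x3 x4 x5) =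
      br (br x1 x2 x3) x4 x5 + br x3 (br x1 x2 x4) x5 + br x3 x4 (br x1 x2 x5)"
    if "x1 \<in> V" "x2 \<in> V" "x3 \<in> V" "x4 \<in> V" "x5 \<in> V" for x1 x2 x3 x4 x5
    using jacobiator_zero[of "\<phi> x1" "\<phi> x2" "\<phi> x3" "\<phi> x4" "\<phi> x5"] that
    by (intro eq) (simp_all add: ev jacobiator_def)
  have swap: "br y x z = - br x y z" "br x z y = - br x y z" if "x \<in> V" "y \<in> V" "z \<in> V" for x y z
    using that by (intro eq; simp add: ev mbracket_swap(1)[of _ _ "\<phi> y" "\<phi> x"]
        mbracket_swap(2)[of _ _ _ "\<phi> z" "\<phi> y"])+
  have add_br: "br (x + x') y z = br x y z + br x' y z" "br y (x + x') z = br y x z + br y x' z"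
    "br y z (x + x') = br y z x + br y z x'" if "x \<in> V" "x' \<in> V" "y \<in> V" "z \<in> V" for x x' y z
    using that by (intro eq; simp add: ev)+
  have scale_br: "br (s c x) y z = s c (br x y z)" "br x (s c y) z = s c (br x y z)"
    "br x y (s c z) = s c (br x y z)" if "x \<in> V" "y \<in> V" "z \<in> V" for c x y z
    using that by (intro eq; simp add: ev)+
  show ?thesis
    unfolding three_lie_algebra_def trilinear_on_def
    by (intro conjI ballI allI assms(1,2) closed fi swap add_br scale_br)
qed

lemma vector_space_fscale: "vector_space fscale"
  by unfold_locales (auto simp: fscale_def fun_eq_iff algebra_simps)

lemma vector_space_tscale: "vector_space tscale"
  by unfold_locales (auto simp: tscale_def fun_eq_iff algebra_simps)

lemma vector_space_dscale: "vector_space s \<Longrightarrow> vector_space (dscale s)"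
  unfolding vector_space_def by (auto simp: dscale_def fscale_def fun_eq_iff algebra_simps)

definition unit4 :: "nat \<Rightarrow> complex^4" where
  "unit4 i = vec4 (if i = 1 then 1 else 0) (if i = 2 then 1 else 0) (if i = 3 then 1 else 0) (if i = 4 then 1 else 0)"

definition fcoords :: "(nat \<Rightarrow> 'a) \<Rightarrow> ('a \<Rightarrow> complex) \<Rightarrow> complex^4" where
  "fcoords e \<xi> = vec4 (\<xi> (e 1)) (\<xi> (e 2)) (\<xi> (e 3)) (\<xi> (e 4))"

definition coords :: "(complex \<Rightarrow> 'a::ab_group_add \<Rightarrow> 'a) \<Rightarrow> (nat \<Rightarrow> 'a) \<Rightarrow> 'a \<Rightarrow> complex^4" where
  "coords s e x = vec4 (dual_basis s e 1 x) (dual_basis s e 2 x) (dual_basis s e 3 x) (dual_basis s e 4 x)"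

lemma atLeastAtMost_1_4: "{1..4::nat} = {1, 2, 3, 4}"
  by auto

section \<open>Bases, dual bases and coordinates\<close>

locale basis4_space = vector_space s for s :: "complex \<Rightarrow> 'a::ab_group_add \<Rightarrow> 'a" +
  fixes e :: "nat \<Rightarrow> 'a"
  assumes basis: "basis4 s e"
begin

abbreviation "crd \<equiv> coords s e"
abbreviation "fcrd \<equiv> fcoords e"

definition vector_of :: "complex^4 \<Rightarrow> 'a" where
  "vector_of v = s (v$1) (e 1) + s (v$2) (e 2) + s (v$3) (e 3) + s (v$4) (e 4)"

definition form_of :: "complex^4 \<Rightarrow> 'a \<Rightarrow> complex" where
  "form_of v = (\<lambda>x. dot4 v (crd x))"

lemma inj_e: "inj_on e {1..4}" and independent_e: "independent (e ` {1..4})"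
  and span_e: "span (e ` {1..4}) = UNIV"
  using basis by (auto simp: basis4_def)

lemma dual_basis_dual: "dual_basis s e i \<in> dual_space s"
  unfolding dual_space_def dual_basis_def
  using linear_representation[OF independent_e span_e] by simp

lemma dual_linear:
  assumes "\<xi> \<in> dual_space s"
  shows "\<xi> (x + y) = \<xi> x + \<xi> y" "\<xi> (s c x) = c * \<xi> x" "\<xi> 0 = 0"
proof -
  interpret l: Vector_Spaces.linear s "(*)" \<xi> using assms by (simp add: dual_space_def)
  show "\<xi> (x + y) = \<xi> x + \<xi> y" "\<xi> (s c x) = c * \<xi> x" "\<xi> 0 = 0"
    by (simp_all add: l.add l.scale)
qed

lemma crd_add [simp]: "crd (x + y) = crd x + crd y"
  and crd_scale [simp]: "crd (s c x) = c *s crd x"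
  by (simp_all add: coords_def vec4_eq_iff dual_linear[OF dual_basis_dual])

lemma dual_basis_basis:
  assumes "i \<in> {1..4}" "j \<in> {1..4}"
  shows "dual_basis s e i (e j) = (if i = j then 1 else 0)"
  unfolding dual_basis_def representation_basis[OF independent_e imageI[OF assms(2)]]
  using inj_on_eq_iff[OF inj_e assms] by simp

lemma crd_e: "i \<in> {1..4} \<Longrightarrow> crd (e i) = unit4 i"
  by (simp add: coords_def dual_basis_basis unit4_def vec4_eq_iff)

lemma fcrd_dual_basis: "i \<in> {1..4} \<Longrightarrow> fcrd (dual_basis s e i) = unit4 i"
  by (simp add: fcoords_def dual_basis_basis unit4_def vec4_eq_iff)

lemma crd_vector_of [simp]: "crd (vector_of v) = v"
  by (simp add: vector_of_def crd_e unit4_def vec4_eq_iff)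

lemma vector_of_crd [simp]: "vector_of (crd x) = x"
proof -
  have "x = (\<Sum>b\<in>e ` {1..4}. s (representation (e ` {1..4}) x b) b)"
    using sum_representation_eq[OF independent_e, of x "e ` {1..4}"] span_e by simp
  also have "\<dots> = (\<Sum>i\<in>{1..4}. s (dual_basis s e i x) (e i))"
    unfolding dual_basis_def sum.reindex[OF inj_e] by simp
  finally have "x = (\<Sum>i\<in>{1..4}. s (dual_basis s e i x) (e i))" .
  then show ?thesis
    unfolding vector_of_def coords_def atLeastAtMost_1_4 by (simp add: add.assoc)
qed

lemma crd_eq_iff: "crd x = crd y \<longleftrightarrow> x = y"
  by (metis vector_of_crd)

lemma form_of_dual [simp]: "form_of v \<in> dual_space s"
proof -
  have "Vector_Spaces.linear s (*) (form_of v)"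
    unfolding Vector_Spaces.linear_iff
    by (simp add: form_of_def dot4_def algebra_simps vector_space_axioms)
      (unfold_locales, auto simp: algebra_simps)
  then show ?thesis by (simp add: dual_space_def)
qed

lemma fcrd_form_of [simp]: "fcrd (form_of v) = v"
  by (simp add: fcoords_def form_of_def crd_e unit4_def dot4_def vec4_eq_iff)

text \<open>A linear functional is determined by its values on the basis; this turns evaluations
  into pairings of coordinate vectors.\<close>

lemma dual_eval: "\<xi> \<in> dual_space s \<Longrightarrow> \<xi> x = dot4 (fcrd \<xi>) (crd x)"
proof -
  assume \<xi>: "\<xi> \<in> dual_space s"
  have "\<xi> x = \<xi> (vector_of (crd x))" by simp
  also have "\<dots> = dot4 (fcrd \<xi>) (crd x)"
    unfolding vector_of_def dual_linear[OF \<xi>] by (simp add: fcoords_def dot4_def mult.commute)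
  finally show ?thesis .
qed

lemma form_of_fcrd: "\<xi> \<in> dual_space s \<Longrightarrow> form_of (fcrd \<xi>) = \<xi>"
  by (simp add: form_of_def fun_eq_iff dual_eval)

lemma fcrd_add [simp]: "fcrd (\<xi> + \<eta>) = fcrd \<xi> + fcrd \<eta>"
  and fcrd_scale [simp]: "fcrd (fscale c \<xi>) = c *s fcrd \<xi>"
  by (simp_all add: fcoords_def fscale_def vec4_eq_iff)

lemma subspace_dual: "module.subspace fscale (dual_space s)"
proof -
  interpret f: vector_space "fscale :: complex \<Rightarrow> ('a \<Rightarrow> complex) \<Rightarrow> _" by (rule vector_space_fscale)
  have "form_of (v + w) = form_of v + form_of w"
    "form_of (c *s v) = fscale c (form_of v)" "form_of 0 = 0" for v w c
    by (simp_all add: form_of_def fun_eq_iff fscale_def dot4_def algebra_simps)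
  then show ?thesis
    unfolding f.subspace_def by (metis form_of_dual form_of_fcrd)
qed

lemma vector_of_linear:
  "vector_of (v + w) = vector_of v + vector_of w" "vector_of (c *s v) = s c (vector_of v)"
  "vector_of (- v) = - vector_of v" "vector_of 0 = 0"
proof -
  show add: "vector_of (v + w) = vector_of v + vector_of w"
    and scale: "vector_of (c *s v) = s c (vector_of v)" for v w c
    by (simp_all flip: crd_eq_iff)
  from scale[of "- 1" v] scale[of 0 0] show "vector_of (- v) = - vector_of v" "vector_of 0 = 0"
    by simp_all
qed

lemma form_of_linear:
  "form_of (v + w) = form_of v + form_of w" "form_of (c *s v) = fscale c (form_of v)"
  "form_of (- v) = - form_of v" "form_of 0 = 0"
  by (simp_all add: form_of_def fun_eq_iff fscale_def dot4_def algebra_simps)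

lemma e_eq: "i \<in> {1..4} \<Longrightarrow> e i = vector_of (unit4 i)"
  by (simp flip: crd_e)

lemma dual_basis_eq: "i \<in> {1..4} \<Longrightarrow> dual_basis s e i = form_of (unit4 i)"
  by (simp flip: fcrd_dual_basis add: form_of_fcrd dual_basis_dual)

section \<open>Coordinates, basis and dimension of the double\<close>

definition double_coords :: "'a \<times> ('a \<Rightarrow> complex) \<Rightarrow> model" where
  "double_coords X = (crd (fst X), fcrd (snd X))"

text \<open>Inverse to \<open>double_coords\<close> only on \<open>double_space s\<close>, since the
  ambient type also contains non-linear functions.\<close>

definition double_of :: "model \<Rightarrow> 'a \<times> ('a \<Rightarrow> complex)" where
  "double_of M = (vector_of (fst M), form_of (snd M))"

lemma double_of_mem [simp]: "double_of M \<in> double_space s"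
  by (simp add: double_of_def double_space_def)

lemma double_coords_of [simp]: "double_coords (double_of M) = M"
  by (simp add: double_coords_def double_of_def)

lemma double_of_coords: "X \<in> double_space s \<Longrightarrow> double_of (double_coords X) = X"
  by (auto simp: double_coords_def double_of_def double_space_def form_of_fcrd)

text \<open>Oriented to collect: a table entry becomes a single \<open>double_of\<close>, and its
  equation one in the model.\<close>

lemma double_of_linear:
  "double_of X + double_of Y = double_of (X + Y)"
  "double_of X - double_of Y = double_of (X - Y)"
  "- double_of X = double_of (- X)"
  "dscale s c (double_of X) = double_of (mscale c X)"
  by (simp_all add: double_of_def vector_of_linear form_of_linear dscale_def mscale_def
      flip: add_uminus_conv_diff)

lemma double_of_eq_iff [simp]: "double_of M = double_of N \<longleftrightarrow> M = N"
  by (metis double_coords_of)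

lemma double_of_eq_0_iff [simp]: "double_of M = 0 \<longleftrightarrow> M = 0"
  using double_of_eq_iff[of M 0] by (simp add: double_of_def vector_of_linear form_of_linear zero_prod_def)

lemma dE_eq: "i \<in> {1..4} \<Longrightarrow> dE e i = double_of (unit4 i, 0)"
  by (simp add: dE_def double_of_def e_eq form_of_linear)

lemma dF_eq: "i \<in> {1..4} \<Longrightarrow> dF s e i = double_of (0, unit4 i)"
  by (simp add: dF_def double_of_def dual_basis_eq vector_of_linear)

lemma subspace_double: "module.subspace (dscale s) (double_space s)"
proof -
  interpret d: vector_space "dscale s" by (rule vector_space_dscale) (rule vector_space_axioms)
  have "X + Y \<in> double_space s" "dscale s c X \<in> double_space s"
    if "X \<in> double_space s" "Y \<in> double_space s" for X Y c
    using double_of_coords[OF that(1)] double_of_coords[OF that(2)]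
    by (metis double_of_linear(1,4) double_of_mem)+
  moreover have "0 \<in> double_space s"
    by (metis double_of_mem double_of_eq_0_iff)
  ultimately show ?thesis
    unfolding d.subspace_def by blast
qed

text \<open>One index for the whole basis: 1 to 4 give the vectors, 5 to 8 the forms. The product
  tables list their arguments in this order.\<close>

definition double_enum :: "nat \<Rightarrow> 'a \<times> ('a \<Rightarrow> complex)" where
  "double_enum i = double_of (if i \<le> 4 then (unit4 i, 0) else (0, unit4 (i - 4)))"

lemma double_basis_eq: "double_basis s e = double_enum ` {1..8}"
proof -
  have "dE e ` {1..4} = double_enum ` {1..4}"
    by (auto simp: dE_eq double_enum_def intro!: image_cong)
  moreover have "dF s e ` {1..4} = (\<lambda>i. double_enum (i + 4)) ` {1..4}"
    by (auto simp: dF_eq double_enum_def intro!: image_cong)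
  moreover have "(\<lambda>i. double_enum (i + 4)) ` {1..4} = double_enum ` {5..8}"
    using image_image[of double_enum "\<lambda>i. i + 4" "{1..4}"] by (simp add: image_add_atLeastAtMost' add.commute)
  moreover have "{1..8::nat} = {1..4} \<union> {5..8}" by auto
  ultimately show ?thesis unfolding double_basis_def by (simp add: image_Un)
qed

lemma inj_double_enum: "inj_on double_enum {1..8}"
proof -
  have "{1..8::nat} = {1,2,3,4,5,6,7,8}" by auto
  then show ?thesis
    by (simp add: inj_on_def double_enum_def unit4_def vec4_eq_iff)
qed

lemma sum_double_enum:
  "(\<Sum>i\<in>{1..8}. dscale s (f i) (double_enum i)) =
    double_of (vec4 (f 1) (f 2) (f 3) (f 4), vec4 (f 5) (f 6) (f 7) (f 8))"
proof -
  have "{1..8::nat} = {1,2,3,4,5,6,7,8}" by auto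
  then show ?thesis
    by (simp add: double_enum_def double_of_linear unit4_def vec4_eq_iff mscale_def)
qed

lemma dim_double: "vector_space.dim (dscale s) (double_space s) = 8"
proof -
  interpret d: vector_space "dscale s" by (rule vector_space_dscale) (rule vector_space_axioms)
  have "double_space s \<subseteq> d.span (double_enum ` {1..8})"
  proof
    fix X assume "X \<in> double_space s"
    then have X: "X = double_of (double_coords X)" by (simp add: double_of_coords)
    obtain v w where vw: "double_coords X = (v, w)" by fastforce
    have "\<exists>f. X = (\<Sum>i\<in>{1..8::nat}. dscale s (f i) (double_enum i))"
    proof (rule exI)
      let ?f = "\<lambda>i. [v$1, v$2, v$3, v$4, w$1, w$2, w$3, w$4] ! (i - 1)"
      show "X = (\<Sum>i\<in>{1..8::nat}. dscale s (?f i) (double_enum i))"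
        unfolding sum_double_enum by (subst X) (simp add: vw vec4_eq_iff)
    qed
    then show "X \<in> d.span (double_enum ` {1..8})"
      by (elim exE ssubst) (intro d.span_sum d.span_scale d.span_base imageI)
  qed
  moreover have "\<not> d.dependent (double_enum ` {1..8})"
  proof -
    have "u v = 0" if "(\<Sum>v\<in>double_enum ` {1..8}. dscale s (u v) v) = 0" "v \<in> double_enum ` {1..8}" for u v
    proof -
      have eq: "{1..8::nat} = {1,2,3,4,5,6,7,8}" by auto
      have "(\<Sum>i\<in>{1..8}. dscale s (u (double_enum i)) (double_enum i)) = 0"
        using that(1) unfolding sum.reindex[OF inj_double_enum] comp_def .
      then have "\<forall>i\<in>{1,2,3,4,5,6,7,8}. u (double_enum i) = 0"
        unfolding sum_double_enum double_of_eq_0_iff by (simp add: vec4_eq_iff prod_eq_iff)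
      with that(2) show ?thesis unfolding eq by auto
    qed
    then show ?thesis
      unfolding d.dependent_finite[OF finite_imageI[OF finite_atLeastAtMost]] by blast
  qed
  moreover have "card (double_enum ` {1..8}) = 8"
    using card_image[OF inj_double_enum] by simp
  moreover have "double_enum ` {1..8} \<subseteq> double_space s"
    by (auto simp: double_enum_def)
  ultimately show ?thesis
    by (metis d.dim_unique)
qed

end

section \<open>Tables of products\<close>

text \<open>Swapping equal arguments gives \<open>v = - v\<close>, which does not force
  \<open>v = 0\<close> in an arbitrary abelian group; here it does because the complex scalar 2 is
  invertible.\<close>

lemma three_lie_algebra_alternating:
  fixes br :: "'v::ab_group_add \<Rightarrow> 'v \<Rightarrow> 'v \<Rightarrow> 'v"
  assumes "three_lie_algebra s V br" "x \<in> V" "z \<in> V"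
  shows "br x x z = 0" "br x z x = 0" "br z x x = 0"
proof -
  interpret vector_space s using assms(1) by (simp add: three_lie_algebra_def)
  have zero: "v = 0" if "v = - v" for v :: 'v
  proof -
    have "s 2 v = s 1 v + s 1 v" unfolding scale_left_distrib[symmetric] by simp
    also have "\<dots> = 0" using that by (simp add: eq_neg_iff_add_eq_0)
    finally show ?thesis by simp
  qed
  have swap: "br b a c = - br a b c" "br a c b = - br a b c" if "a \<in> V" "b \<in> V" "c \<in> V" for a b c
    using assms(1) that unfolding three_lie_algebra_def by blast+
  show "br x x z = 0" and a: "br z x x = 0"
    by (rule zero, rule swap; fact)+
  show "br x z x = 0"
    using swap(1)[of z x x] a assms by simp
qed

text \<open>Only increasing triples have to be inspected: a repeated index gives zero, and a
  transposition changes the bracket by a sign but not the set of its arguments.\<close>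

lemma has_productsI:
  fixes b :: "nat \<Rightarrow> 'v::ab_group_add"
  assumes lie: "three_lie_algebra s V br" and S: "S = b ` {1..n}" "S \<subseteq> V"
    and table: "\<forall>(u, v, w, r)\<in>set T. br u v w = r"
    and zero: "\<forall>i\<in>{1..n}. \<forall>j\<in>{1..n}. \<forall>k\<in>{1..n}. i < j \<longrightarrow> j < k \<longrightarrow>
      (b i, b j, b k) \<in> (\<lambda>(u, v, w, r). (u, v, w)) ` set T \<or> br (b i) (b j) (b k) = 0"
  shows "has_products S T br"
proof -
  define P where "P u v w \<longleftrightarrow>
    ((\<forall>(u', v', w', r)\<in>set T. {u', v', w'} \<noteq> {u, v, w}) \<longrightarrow> br u v w = 0)" for u v w
  have V: "b i \<in> V" if "i \<in> {1..n}" for i using S that by auto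
  have swap: "br v u w = - br u v w" "br u w v = - br u v w" if "u \<in> V" "v \<in> V" "w \<in> V" for u v w
    using lie that unfolding three_lie_algebra_def by blast+
  have P1: "P v u w" if "P u v w" "u \<in> V" "v \<in> V" "w \<in> V" for u v w
    using that(1) unfolding P_def by (simp add: swap(1)[OF that(2-4)] insert_commute)
  have P2: "P u w v" if "P u v w" "u \<in> V" "v \<in> V" "w \<in> V" for u v w
    using that(1) unfolding P_def by (simp add: swap(2)[OF that(2-4)] insert_commute)
  have sorted: "P (b i) (b j) (b k)" if "i \<in> {1..n}" "j \<in> {1..n}" "k \<in> {1..n}" "i < j" "j < k" for i j k
    using zero[rule_format, OF that] unfolding P_def by force
  have "P (b i) (b j) (b k)" if i: "i \<in> {1..n}" and j: "j \<in> {1..n}" and k: "k \<in> {1..n}" for i j k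
  proof -
    note V = V[OF i] V[OF j] V[OF k]
    \<comment> \<open>Three coincidences and six strict orders; the latter are sorted by the
      adjacent transpositions \<open>P1\<close> and \<open>P2\<close>.\<close>
    consider "i = j" | "i = k" | "j = k" | "i < j" "j < k" | "i < k" "k < j" | "j < i" "i < k"
      | "j < k" "k < i" | "k < i" "i < j" | "k < j" "j < i"
      using nat_neq_iff[of i j] nat_neq_iff[of i k] nat_neq_iff[of j k] by blast
    then show ?thesis
    proof cases
      case 4 then show ?thesis by (rule sorted[OF i j k])
    next
      case 5 then show ?thesis by (intro P2[OF sorted[OF i k j]] V)
    next
      case 6 then show ?thesis by (intro P1[OF sorted[OF j i k]] V)
    next
      case 7 then show ?thesis by (intro P1[OF P2[OF sorted[OF j k i]]] V)
    next
      case 8 then show ?thesis by (intro P2[OF P1[OF sorted[OF k i j]]] V)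
    next
      case 9 then show ?thesis by (intro P1[OF P2[OF P1[OF sorted[OF k j i]]]] V)
    qed (use three_lie_algebra_alternating[OF lie] V in \<open>simp_all add: P_def\<close>)
  qed
  then show ?thesis
    unfolding has_products_def S(1) using table by (auto simp: P_def)
qed

section \<open>The bialgebra of a symmetric pair\<close>

text \<open>With \<open>S\<close> and \<open>T\<close> moved across the pairing, each term is a
  determinant with one row multiplied by \<open>S\<close> or \<open>T\<close>. The second summand
  has the determinants of the first with two rows exchanged, so the eight terms for each matrix
  cancel in pairs.\<close>

lemma mform_invariant:
  assumes "transpose S = S" "transpose T = T"
  shows "mform (mbracket S T X1 X2 X3) X4 + mform (mbracket S T X1 X2 X4) X3 = 0"
proof -
  let ?d = "\<lambda>a b c. dot4 (cross4 a b c)"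
  have swap: "?d a b c d = - ?d a b d c" "?d a b c d = - ?d a d c b" "?d a b c d = - ?d d b c a" for a b c d
    by (simp_all add: dot4_def cross4_nth minor3_def algebra_simps)
  have cancel: "?d x1 x2 x3 (R *v y4) + ?d x1 x2 (R *v y3) x4 + ?d x2 x3 (R *v y1) x4 + ?d x3 x1 (R *v y2) x4
    + (?d x1 x2 x4 (R *v y3) + ?d x1 x2 (R *v y4) x3 + ?d x2 x4 (R *v y1) x3 + ?d x4 x1 (R *v y2) x3) = 0"
    for R :: "complex^4^4" and x1 x2 x3 x4 y1 y2 y3 y4
    using swap(1)[of x1 x2 x3 "R *v y4"] swap(1)[of x1 x2 "R *v y3" x4]
      swap(2)[of x2 x3 "R *v y1" x4] swap(3)[of x3 x1 "R *v y2" x4]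
    by simp
  have add: "dot4 (u + v) w = dot4 u w + dot4 v w" for u v w
    by (simp add: dot4_def algebra_simps)
  show ?thesis
    using arg_cong2[OF
        cancel[of "fst X1" "fst X2" "fst X3" S "snd X4" "snd X3" "fst X4" "snd X1" "snd X2"]
        cancel[of "snd X1" "snd X2" "snd X3" T "fst X4" "fst X3" "snd X4" "fst X1" "fst X2"], of "(+)"]
    unfolding mform_def mbracket_def split_beta fst_conv snd_conv add
      dot4_symmetric[OF assms(1)] dot4_symmetric[OF assms(2)]
    by (simp add: add_ac)
qed

section \<open>The bialgebra and its double in terms of the two matrices\<close>

locale bialgebra_coordinates = basis4_space s e + symmetric_pair S T l
  for s :: "complex \<Rightarrow> 'a::ab_group_add \<Rightarrow> 'a" and e S T l
begin

definition abr :: "'a \<Rightarrow> 'a \<Rightarrow> 'a \<Rightarrow> 'a" where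
  "abr x y z = vector_of (S *v cross4 (crd x) (crd y) (crd z))"

text \<open>The trivector dual to \<open>w\<close> under the volume form. The value 0 off the dual
  space is the convention of \<open>pure_tensor\<close>, so that equality of tensors is equality of
  functions.\<close>

definition alt_tensor :: "complex^4 \<Rightarrow> 'a tensor3" where
  "alt_tensor w = (\<lambda>\<xi> \<eta> \<zeta>. if \<xi> \<in> dual_space s \<and> \<eta> \<in> dual_space s \<and> \<zeta> \<in> dual_space s
     then dot4 (cross4 (fcrd \<xi>) (fcrd \<eta>) (fcrd \<zeta>)) w else 0)"

definition cobr :: "'a \<Rightarrow> 'a tensor3" where
  "cobr x = alt_tensor (T *v crd x)"

abbreviation "dbr \<equiv> manin_bracket s abr cobr"

lemma alt_tensor_linear:
  "alt_tensor (v + w) = alt_tensor v + alt_tensor w" "alt_tensor (c *s v) = tscale c (alt_tensor v)"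
  "alt_tensor (- v) = - alt_tensor v" "alt_tensor 0 = 0" "alt_tensor (v - w) = alt_tensor v - alt_tensor w"
  by (auto simp: alt_tensor_def fun_eq_iff tscale_def dot4_def algebra_simps)

text \<open>A wedge of three basis vectors evaluates forms by a 3 x 3 minor, which is the remaining
  component of the cross product up to its cofactor sign.\<close>

lemma wedge3_eq:
  "wedge3 s (e 1) (e 2) (e 3) = alt_tensor (unit4 4)"
  "wedge3 s (e 1) (e 2) (e 4) = alt_tensor (- unit4 3)"
  "wedge3 s (e 1) (e 3) (e 4) = alt_tensor (unit4 2)"
  "wedge3 s (e 2) (e 3) (e 4) = alt_tensor (- unit4 1)"
  by (simp_all add: wedge3_def alt_tensor_def pure_tensor_def fun_eq_iff dot4_def unit4_def
      cross4_nth minor3_def fcoords_def)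

lemma alt_tensor_cube: "alt_tensor w \<in> tensor_cube s"
proof -
  interpret t: vector_space "tscale :: complex \<Rightarrow> 'a tensor3 \<Rightarrow> _" by (rule vector_space_tscale)
  have wedge: "wedge3 s x y z \<in> tensor_cube s" for x y z
    unfolding tensor_cube_def wedge3_def
    by (intro t.span_add t.span_diff t.span_base) auto
  have "w = w$4 *s unit4 4 - w$3 *s (- unit4 3) + w$2 *s unit4 2 - w$1 *s (- unit4 1)"
    by (simp add: vec4_eq_iff unit4_def)
  then have "alt_tensor w = tscale (w$4) (wedge3 s (e 1) (e 2) (e 3))
    - tscale (w$3) (wedge3 s (e 1) (e 2) (e 4)) + tscale (w$2) (wedge3 s (e 1) (e 3) (e 4))
    - tscale (w$1) (wedge3 s (e 2) (e 3) (e 4))"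
    unfolding wedge3_eq alt_tensor_linear[symmetric] by simp
  then show ?thesis
    using wedge unfolding tensor_cube_def
    by (simp add: t.span_add t.span_diff t.span_scale)
qed

lemma dual_bracket_eq:
  assumes "\<xi> \<in> dual_space s" "\<eta> \<in> dual_space s" "\<zeta> \<in> dual_space s"
  shows "dual_bracket cobr \<xi> \<eta> \<zeta> = form_of (T *v cross4 (fcrd \<xi>) (fcrd \<eta>) (fcrd \<zeta>))"
  using assms by (simp add: dual_bracket_def cobr_def alt_tensor_def form_of_def dot4_symmetric[OF T_sym])

text \<open>The vector is found by moving \<open>\<gamma>\<close> out of the determinant, and it is
  unique because linear forms separate points.\<close>

lemma dual_coad_eq:
  assumes "\<xi> \<in> dual_space s" "\<eta> \<in> dual_space s"
  shows "dual_coad s cobr \<xi> \<eta> x = vector_of (cross4 (fcrd \<xi>) (fcrd \<eta>) (T *v crd x))"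
proof -
  have *: "- dual_bracket cobr \<xi> \<eta> \<gamma> x = dot4 (fcrd \<gamma>) (cross4 (fcrd \<xi>) (fcrd \<eta>) (T *v crd x))"
    if "\<gamma> \<in> dual_space s" for \<gamma>
    using assms that dot4_cross4_swap[of "fcrd \<xi>" "fcrd \<eta>" "fcrd \<gamma>" "T *v crd x"]
    by (simp add: dual_bracket_def cobr_def alt_tensor_def dot4_commute)
  show ?thesis
    unfolding dual_coad_def
  proof (rule the_equality)
    show "\<forall>\<gamma>\<in>dual_space s. \<gamma> (vector_of (cross4 (fcrd \<xi>) (fcrd \<eta>) (T *v crd x))) =
        - dual_bracket cobr \<xi> \<eta> \<gamma> x"
      by (simp add: * dual_eval)
  next
    fix u assume u: "\<forall>\<gamma>\<in>dual_space s. \<gamma> u = - dual_bracket cobr \<xi> \<eta> \<gamma> x"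
    have "dot4 v (crd u) = dot4 v (cross4 (fcrd \<xi>) (fcrd \<eta>) (T *v crd x))" for v
      using u[rule_format, OF form_of_dual[of v]] *[OF form_of_dual[of v]] by (simp add: dual_eval)
    from this[of "unit4 1"] this[of "unit4 2"] this[of "unit4 3"] this[of "unit4 4"]
    have "crd u = cross4 (fcrd \<xi>) (fcrd \<eta>) (T *v crd x)"
      by (simp add: dot4_def unit4_def vec4_eq_iff)
    then show "u = vector_of (cross4 (fcrd \<xi>) (fcrd \<eta>) (T *v crd x))"
      by (simp flip: crd_eq_iff)
  qed
qed

text \<open>The symmetry of \<open>S\<close> and an exchange of two rows free the argument
  \<open>z\<close>; the sign of the exchange absorbs the one in \<open>coad\<close>.\<close>

lemma coad_eq:
  assumes "\<gamma> \<in> dual_space s"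
  shows "coad abr x y \<gamma> = form_of (cross4 (crd x) (crd y) (S *v fcrd \<gamma>))"
proof
  fix z
  have "coad abr x y \<gamma> z = - dot4 (S *v cross4 (crd x) (crd y) (crd z)) (fcrd \<gamma>)"
    using assms by (simp add: coad_def abr_def dual_eval dot4_commute)
  also have "\<dots> = dot4 (cross4 (crd x) (crd y) (S *v fcrd \<gamma>)) (crd z)"
    by (simp add: dot4_symmetric[OF S_sym] dot4_cross4_swap[of _ _ "crd z"])
  finally show "coad abr x y \<gamma> z = form_of (cross4 (crd x) (crd y) (S *v fcrd \<gamma>)) z"
    by (simp add: form_of_def)
qed

lemma dbr_eq:
  assumes "X \<in> double_space s" "Y \<in> double_space s" "Z \<in> double_space s"
  shows "dbr X Y Z = double_of (mbracket S T (double_coords X) (double_coords Y) (double_coords Z))"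
  using assms
  by (auto simp: double_space_def manin_bracket_def mbracket_def double_coords_def double_of_def
      dual_bracket_eq dual_coad_eq coad_eq abr_def vector_of_linear form_of_linear)

lemma dbr_double_of [simp]:
  "dbr (double_of X) (double_of Y) (double_of Z) = double_of (mbracket S T X Y Z)"
  by (simp add: dbr_eq)

lemma double_coords_linear:
  "double_coords (X + Y) = double_coords X + double_coords Y"
  "double_coords (dscale s c X) = mscale c (double_coords X)"
  by (simp_all add: double_coords_def dscale_def mscale_def)

lemma inj_double_coords: "inj_on double_coords (double_space s)"
  by (metis inj_onI double_of_coords)

lemma three_lie_subspace:
  assumes "V \<subseteq> double_space s" "module.subspace (dscale s) V"
    "\<And>X Y Z. X \<in> V \<Longrightarrow> Y \<in> V \<Longrightarrow> Z \<in> V \<Longrightarrow> dbr X Y Z \<in> V"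
  shows "three_lie_algebra (dscale s) V dbr"
  by (rule three_lie_algebra_transport[where \<phi> = double_coords])
    (use assms in \<open>auto simp: double_coords_linear dbr_eq subset_iff vector_space_dscale
      vector_space_axioms intro: inj_on_subset[OF inj_double_coords]\<close>)

lemma three_lie_double: "three_lie_algebra (dscale s) (double_space s) dbr"
  by (rule three_lie_subspace) (auto simp: subspace_double dbr_eq)

lemma pseudo_metric_double:
  "pseudo_metric_three_lie_algebra (dscale s) (double_space s) dbr form_plus"
proof -
  have form: "form_plus X Y = mform (double_coords X) (double_coords Y)"
    if "X \<in> double_space s" "Y \<in> double_space s" for X Y
    using that by (auto simp: form_plus_def mform_def double_coords_def double_space_def dual_eval dot4_commute)
  have "X = 0" if X: "X \<in> double_space s" and zero: "\<forall>Y\<in>double_space s. form_plus X Y = 0" for X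
  proof -
    have "mform (double_coords X) M = 0" for M
      using zero form[OF X double_of_mem[of M]] by simp
    from this[of "(unit4 1, 0)"] this[of "(unit4 2, 0)"] this[of "(unit4 3, 0)"] this[of "(unit4 4, 0)"]
      this[of "(0, unit4 1)"] this[of "(0, unit4 2)"] this[of "(0, unit4 3)"] this[of "(0, unit4 4)"]
    have "double_coords X = 0"
      by (simp add: mform_def dot4_def unit4_def prod_eq_iff vec4_eq_iff)
    then show "X = 0"
      using double_of_coords[OF X] double_of_eq_0_iff[of 0] by simp
  qed
  moreover have "bilinear_form_on (dscale s) (double_space s) form_plus"
    unfolding bilinear_form_on_def
    by (auto simp: form_plus_def double_space_def dscale_def fscale_def dual_linear algebra_simps)
  moreover have "form_plus X Y = form_plus Y X" for X Y :: "'a \<times> ('a \<Rightarrow> complex)"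
    by (simp add: form_plus_def)
  moreover have "form_plus (dbr X1 X2 X3) X4 + form_plus (dbr X1 X2 X4) X3 = 0"
    if "X1 \<in> double_space s" "X2 \<in> double_space s" "X3 \<in> double_space s" "X4 \<in> double_space s"
    for X1 X2 X3 X4
    using that mform_invariant[OF S_sym T_sym] by (simp add: form dbr_eq)
  ultimately show ?thesis
    unfolding pseudo_metric_three_lie_algebra_def using three_lie_double by blast
qed

lemma manin_triple_double:
  "manin_triple (dscale s) (double_space s) dbr form_plus (UNIV \<times> {0}) ({0} \<times> dual_space s)"
proof -
  interpret d: vector_space "dscale s" by (rule vector_space_dscale) (rule vector_space_axioms)
  interpret f: vector_space "fscale :: complex \<Rightarrow> ('a \<Rightarrow> complex) \<Rightarrow> _" by (rule vector_space_fscale)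
  note dual = f.subspace_add[OF subspace_dual] f.subspace_scale[OF subspace_dual] f.subspace_0[OF subspace_dual]
  have A: "(x, 0) = double_of (crd x, 0)" for x
    by (simp add: double_of_def form_of_linear)
  have F: "(0, \<xi>) = double_of (0, fcrd \<xi>)" if "\<xi> \<in> dual_space s" for \<xi>
    using that by (simp add: double_of_def vector_of_linear form_of_fcrd)
  have sub: "d.subspace (UNIV \<times> {0})" "d.subspace ({0} \<times> dual_space s)"
     apply (auto simp: d.subspace_def dscale_def fscale_def zero_prod_def)[1]
    by (auto simp: d.subspace_def dual dscale_def zero_prod_def)
  \<comment> \<open>Pairs are passed to the model, where one component of the bracket is visibly
    zero, and then read back.\<close>
  have lie1: "three_lie_algebra (dscale s) (UNIV \<times> {0}) dbr"
    by (rule three_lie_subspace[OF _ sub(1)])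
      (auto simp: double_space_def dual A mbracket_def, auto simp: double_of_def form_of_linear)
  have lie2: "three_lie_algebra (dscale s) ({0} \<times> dual_space s) dbr"
    by (rule three_lie_subspace[OF _ sub(2)])
      (auto simp: double_space_def dual F mbracket_def, auto simp: double_of_def vector_of_linear)
  have mixed: "dbr (x, 0) (y, 0) (0, \<xi>) \<in> {0} \<times> dual_space s"
      "dbr (0, \<xi>) (0, \<eta>) (x, 0) \<in> UNIV \<times> {0}"
    if "\<xi> \<in> dual_space s" "\<eta> \<in> dual_space s" for x y \<xi> \<eta>
    unfolding A F[OF that(1)] F[OF that(2)] dbr_double_of
    by (simp_all add: mbracket_def) (simp_all add: double_of_def vector_of_linear form_of_linear)
  have sum: "(UNIV \<times> {0}) \<inter> ({0} \<times> dual_space s) = {0}"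
      "double_space s = {x + y | x y. x \<in> UNIV \<times> {0} \<and> y \<in> {0} \<times> dual_space s}"
    using dual(3) by (auto simp: zero_prod_def double_space_def)
  show ?thesis
    unfolding manin_triple_def
  proof (intro conjI ballI pseudo_metric_double lie1 lie2 sum)
    fix X Y Z :: "'a \<times> ('a \<Rightarrow> complex)"
    show "form_plus X Y = 0" if "X \<in> UNIV \<times> {0}" "Y \<in> UNIV \<times> {0}"
      using that by (auto simp: form_plus_def)
    show "form_plus X Y = 0" if "X \<in> {0} \<times> dual_space s" "Y \<in> {0} \<times> dual_space s"
      using that by (auto simp: form_plus_def dual_linear)
    show "dbr X Y Z \<in> {0} \<times> dual_space s"
      if "X \<in> UNIV \<times> {0}" "Y \<in> UNIV \<times> {0}" "Z \<in> {0} \<times> dual_space s"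
      using that by (elim SigmaE singletonE ssubst) (rule mixed)
    show "dbr X Y Z \<in> UNIV \<times> {0}"
      if "X \<in> {0} \<times> dual_space s" "Y \<in> {0} \<times> dual_space s" "Z \<in> UNIV \<times> {0}"
      using that by (elim SigmaE singletonE ssubst) (rule mixed)
  qed
qed

text \<open>Describes what \<open>tensor_map\<close> does to an argument in a leg with
  \<open>abr y z\<close>: precomposition is minus the coadjoint action.\<close>

lemma fcrd_comp_abr:
  assumes "\<zeta> \<in> dual_space s"
  shows "\<zeta> \<circ> abr y z \<in> dual_space s" "fcrd (\<zeta> \<circ> abr y z) = - cross4 (crd y) (crd z) (S *v fcrd \<zeta>)"
proof -
  have "\<zeta> (abr y z x) = form_of (- cross4 (crd y) (crd z) (S *v fcrd \<zeta>)) x" for x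
    using fun_cong[OF coad_eq[OF assms, of y z], of x]
    by (simp add: form_of_linear coad_def minus_equation_iff[of "\<zeta> _"] eq_commute)
  then have "\<zeta> \<circ> abr y z = form_of (- cross4 (crd y) (crd z) (S *v fcrd \<zeta>))"
    by (simp add: fun_eq_iff)
  then show "\<zeta> \<circ> abr y z \<in> dual_space s" "fcrd (\<zeta> \<circ> abr y z) = - cross4 (crd y) (crd z) (S *v fcrd \<zeta>)"
    by simp_all
qed

text \<open>Evaluated on \<open>\<xi>\<close>, \<open>\<eta>\<close>, \<open>\<zeta>\<close>, the
  coproduct of \<open>[x, y, z]\<close> is \<open>l\<close> times the pairing of the two cross
  products, by \<open>T S = l I\<close>. Letting \<open>\<xi>\<close>, \<open>\<eta>\<close> act on
  the product of \<open>x\<close>, \<open>y\<close>, \<open>z\<close> gives the first condition;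
  letting \<open>y\<close>, \<open>z\<close> act on that of the forms gives the second.\<close>

lemma double_construction: "double_construction_bialgebra s abr cobr"
proof -
  interpret dual: symmetric_pair T S l
    by unfold_locales (simp_all add: S_sym T_sym ST TS)
  have dot: "dot4 (a + b) c = dot4 a c + dot4 b c" "dot4 (- a) c = - dot4 a c" "dot4 a (- c) = - dot4 a c" for a b c
    by (simp_all add: dot4_def algebra_simps)
  have ev: "cobr x \<xi> \<eta> \<zeta> = dot4 (cross4 (fcrd \<xi>) (fcrd \<eta>) (fcrd \<zeta>)) (T *v crd x)"
    if "\<xi> \<in> dual_space s" "\<eta> \<in> dual_space s" "\<zeta> \<in> dual_space s" for x \<xi> \<eta> \<zeta>
    using that by (simp add: cobr_def alt_tensor_def)
  have inj_crd: "inj (\<lambda>x. (crd x, 0::complex^4))"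
    by (simp add: inj_on_def crd_eq_iff)
  \<comment> \<open>\<open>A\<close> is embedded as the half of the model without forms; its dual,
    below, as the half without vectors.\<close>
  have "three_lie_algebra s UNIV abr"
    by (rule three_lie_algebra_transport[where \<phi> = "\<lambda>x. (crd x, 0)"])
      (auto simp: vector_space_axioms inj_crd mscale_def mbracket_def abr_def)
  moreover have "Vector_Spaces.linear s tscale cobr"
    unfolding Vector_Spaces.linear_iff
    by (simp add: vector_space_axioms vector_space_tscale cobr_def alt_tensor_linear
        matrix_vector_right_distrib vector_scalar_commute)
  moreover have "range cobr \<subseteq> tensor_cube s"
    by (auto simp: cobr_def alt_tensor_cube)
  moreover have "three_lie_algebra fscale (dual_space s) (dual_bracket cobr)"
    by (rule three_lie_algebra_transport[where \<phi> = "\<lambda>\<xi>. (0, fcrd \<xi>)"])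
      (auto simp: vector_space_fscale subspace_dual mscale_def mbracket_def dual_bracket_eq
        intro!: inj_onI, metis form_of_fcrd)
  moreover have "cobr (abr x y z) = tensor_map s id id (abr y z) (cobr x)
      + tensor_map s id id (abr z x) (cobr y) + tensor_map s id id (abr x y) (cobr z)" for x y z
  proof (intro ext)
    fix \<xi> \<eta> \<zeta>
    show "cobr (abr x y z) \<xi> \<eta> \<zeta> = (tensor_map s id id (abr y z) (cobr x)
      + tensor_map s id id (abr z x) (cobr y) + tensor_map s id id (abr x y) (cobr z)) \<xi> \<eta> \<zeta>"
    proof (cases "\<xi> \<in> dual_space s \<and> \<eta> \<in> dual_space s \<and> \<zeta> \<in> dual_space s")
      case True
      let ?x = "crd x" and ?y = "crd y" and ?z = "crd z" and ?\<xi> = "fcrd \<xi>" and ?\<eta> = "fcrd \<eta>" and ?\<zeta> = "fcrd \<zeta>"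
      \<comment> \<open>Moves \<open>v\<close> and \<open>w\<close> from the inner product onto
        \<open>S *v ?\<zeta>\<close>, the shape in which \<open>fcrd_comp_abr\<close> presents
        them.\<close>
      have pairing: "dot4 (cross4 (cross4 ?\<xi> ?\<eta> a) v w) (S *v ?\<zeta>) = dot4 (cross4 ?\<xi> ?\<eta> (cross4 v w (S *v ?\<zeta>))) a" for a v w
        by (metis cross4_rotate dot4_cross4_swap dot4_commute add.inverse_inverse)
      have "l * dot4 (cross4 ?\<xi> ?\<eta> ?\<zeta>) (cross4 ?x ?y ?z) = - dot4 (l *s cross4 ?\<xi> ?\<eta> (cross4 ?x ?y ?z)) ?\<zeta>"
        by (simp add: dot4_cross4_swap[of _ _ ?\<zeta>])
      also have "\<dots> = - (dot4 (cross4 (cross4 ?\<xi> ?\<eta> (T *v ?x)) ?y ?z) (S *v ?\<zeta>)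
          + dot4 (cross4 (cross4 ?\<xi> ?\<eta> (T *v ?y)) ?z ?x) (S *v ?\<zeta>)
          + dot4 (cross4 (cross4 ?\<xi> ?\<eta> (T *v ?z)) ?x ?y) (S *v ?\<zeta>))"
        unfolding dual.ad_AA_FFF dot4_symmetric[OF S_sym] dot
        by (simp add: cross4_rotate[of _ "cross4 ?\<xi> ?\<eta> (T *v ?y)" ?z] cross4_rotate[of "cross4 ?\<xi> ?\<eta> (T *v ?z)" ?x ?y])
      finally show ?thesis
        using True unfolding pairing
        by (simp add: tensor_map_def ev fcrd_comp_abr dot abr_def TS)
    next
      case False
      then show ?thesis by (auto simp: cobr_def alt_tensor_def tensor_map_def)
    qed
  qed
  moreover have "cobr (abr x y z) = tensor_map s id id (abr y z) (cobr x)
      + tensor_map s id (abr y z) id (cobr x) + tensor_map s (abr y z) id id (cobr x)" for x y z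
  proof (intro ext)
    fix \<xi> \<eta> \<zeta>
    show "cobr (abr x y z) \<xi> \<eta> \<zeta> = (tensor_map s id id (abr y z) (cobr x)
      + tensor_map s id (abr y z) id (cobr x) + tensor_map s (abr y z) id id (cobr x)) \<xi> \<eta> \<zeta>"
    proof (cases "\<xi> \<in> dual_space s \<and> \<eta> \<in> dual_space s \<and> \<zeta> \<in> dual_space s")
      case True
      let ?x = "crd x" and ?y = "crd y" and ?z = "crd z" and ?\<xi> = "fcrd \<xi>" and ?\<eta> = "fcrd \<eta>" and ?\<zeta> = "fcrd \<zeta>"
      have "l * dot4 (cross4 ?\<xi> ?\<eta> ?\<zeta>) (cross4 ?x ?y ?z) = - dot4 (l *s cross4 ?y ?z (cross4 ?\<xi> ?\<eta> ?\<zeta>)) ?x"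
        by (simp add: dot4_cross4_swap[of ?y ?z _ ?x] cross4_rotate[of ?x ?y ?z]
            dot4_commute[of "cross4 ?\<xi> ?\<eta> ?\<zeta>"])
      also have "\<dots> = - (dot4 (cross4 ?\<xi> ?\<eta> (cross4 ?y ?z (S *v ?\<zeta>))) (T *v ?x)
          + dot4 (cross4 ?\<xi> (cross4 ?y ?z (S *v ?\<eta>)) ?\<zeta>) (T *v ?x)
          + dot4 (cross4 (cross4 ?y ?z (S *v ?\<xi>)) ?\<eta> ?\<zeta>) (T *v ?x))"
        unfolding ad_AA_FFF dot4_symmetric[OF T_sym] dot by simp
      finally show ?thesis
        using True by (simp add: tensor_map_def ev fcrd_comp_abr dot abr_def TS)
    next
      case False
      then show ?thesis by (auto simp: cobr_def alt_tensor_def tensor_map_def)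
    qed
  qed
  ultimately show ?thesis
    unfolding double_construction_bialgebra_def by blast
qed

lemma corresponds: "corresponds_to_bialgebra s dbr abr cobr"
  by (simp add: corresponds_to_bialgebra_def double_construction manin_triple_double)

end

section \<open>The four families\<close>

lemma unit4_nth [simp]:
  "unit4 i $ 1 = (if i = 1 then 1 else 0)" "unit4 i $ 2 = (if i = 2 then 1 else 0)"
  "unit4 i $ 3 = (if i = 3 then 1 else 0)" "unit4 i $ 4 = (if i = 4 then 1 else 0)"
  by (simp_all add: unit4_def)

context bialgebra_coordinates
begin

text \<open>Of the index triples only the 56 increasing ones carry content, to be settled by
  evaluation in the model.\<close>

lemma double_has_productsI:
  assumes "\<forall>(u, v, w, r)\<in>set L. dbr u v w = r"
    and "\<forall>i\<in>{1..8}. \<forall>j\<in>{1..8}. \<forall>k\<in>{1..8}. i < j \<longrightarrow> j < k \<longrightarrow>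
      (double_enum i, double_enum j, double_enum k) \<in> (\<lambda>(u, v, w, r). (u, v, w)) ` set L \<or>
      dbr (double_enum i) (double_enum j) (double_enum k) = 0"
  shows "has_products (double_basis s e) L dbr"
  by (rule has_productsI[OF three_lie_double double_basis_eq _ assms])
    (auto simp: double_basis_eq double_enum_def)

lemma abr_lie: "three_lie_algebra s UNIV abr"
  using double_construction by (simp add: double_construction_bialgebra_def)

lemma abr_e:
  "\<lbrakk>i \<in> {1..4}; j \<in> {1..4}; k \<in> {1..4}\<rbrakk> \<Longrightarrow>
    abr (e i) (e j) (e k) = vector_of (S *v cross4 (unit4 i) (unit4 j) (unit4 k))"
  by (simp add: abr_def crd_e)

lemma abr_has_productsI:
  assumes "\<forall>(u, v, w, r)\<in>set L. abr u v w = r"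
    and "\<forall>i\<in>{1..4}. \<forall>j\<in>{1..4}. \<forall>k\<in>{1..4}. i < j \<longrightarrow> j < k \<longrightarrow>
      (e i, e j, e k) \<in> (\<lambda>(u, v, w, r). (u, v, w)) ` set L \<or> abr (e i) (e j) (e k) = 0"
  shows "has_products (e ` {1..4}) L abr"
  by (rule has_productsI[OF abr_lie refl _ assms]) auto

lemma cobr_e: "i \<in> {1..4} \<Longrightarrow> cobr (e i) = alt_tensor (T *v unit4 i)"
  by (simp add: cobr_def crd_e)

lemma vector_of_eq_e_iff: "i \<in> {1..4} \<Longrightarrow> vector_of u = e i \<longleftrightarrow> u = unit4 i"
  by (simp add: e_eq) (metis crd_vector_of)

lemma vector_of_eq_0_iff [simp]: "vector_of u = 0 \<longleftrightarrow> u = 0"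
  by (metis crd_vector_of vector_of_linear(4))

text \<open>On unit forms with three distinct indices the tensor returns, up to sign, one coordinate
  of its vector; four such triples recover them all.\<close>

lemma alt_tensor_eq_iff: "alt_tensor u = alt_tensor v \<longleftrightarrow> u = v"
proof
  assume "alt_tensor u = alt_tensor v"
  then have "alt_tensor u (form_of (unit4 i)) (form_of (unit4 j)) (form_of (unit4 k)) =
      alt_tensor v (form_of (unit4 i)) (form_of (unit4 j)) (form_of (unit4 k))" for i j k
    by simp
  from this[of 1 2 3] this[of 1 2 4] this[of 1 3 4] this[of 2 3 4] show "u = v"
    by (simp add: alt_tensor_def dot4_def cross4_nth minor3_def vec4_eq_iff)
qed simp

lemmas alt_tensor_simps = wedge3_eq alt_tensor_linear[symmetric] alt_tensor_eq_iff

end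

lemma atLeastAtMost_1_8: "{1..8::nat} = {1, 2, 3, 4, 5, 6, 7, 8}"
  by auto

lemma Pair_eq_0_iff: "(a, b) = 0 \<longleftrightarrow> a = 0 \<and> b = 0"
  by (simp add: prod_eq_iff)

lemmas model_simps = mbracket_def vec4_eq_iff cross4_nth minor3_def mult_vec4_nth mscale_def Pair_eq_0_iff

section \<open>The matrices of the four families\<close>

context basis4_space
begin

text \<open>
  The signs in \<open>S\<close> and \<open>T\<close> come from \<open>e\<^sub>i \<times> e\<^sub>j \<times> e\<^sub>k = \<plusminus>e\<^sub>m\<close> for \<open>i < j < k\<close>, with sign \<open>+\<close> iff \<open>m\<close> is
  even; they are what makes \<open>T\<close> symmetric for \<open>B\<^sub>2\<close> and \<open>B\<^sub>3\<close>.
\<close>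

lemma bialgebra_B1_double:
  "\<exists>br \<Delta> dbr. bialgebra_B1 s e k br \<Delta> \<and>
    pseudo_metric_three_lie_algebra (dscale s) (double_space s) dbr form_plus \<and>
    has_products (double_basis s e) (products_1 (dscale s) (dE e) (dF s e) k) dbr \<and>
    corresponds_to_bialgebra s dbr br \<Delta>"
proof -
  define S where "S = vec4 (- unit4 1) (unit4 2) (- unit4 3) (unit4 4)"
  define T where "T = vec4 (- k *s unit4 1) (k *s unit4 2) (- k *s unit4 3) (k *s unit4 4)"
  have rows: "S$1 = - unit4 1" "S$2 = unit4 2" "S$3 = - unit4 3" "S$4 = unit4 4"
    "T$1 = - k *s unit4 1"
    "T$2 = k *s unit4 2"
    "T$3 = - k *s unit4 3"
    "T$4 = k *s unit4 4"
    by (simp_all add: S_def T_def)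
  \<comment> \<open>\<open>T\<close> is \<open>k\<close> times \<open>S\<close>, and
    \<open>S\<close> squares to the identity, so \<open>l = k\<close>.\<close>
  interpret bialgebra_coordinates s e S T k
    by unfold_locales (simp_all add: rows transpose_def vec4_eq_iff mult_vec4_nth)
  have "has_products (double_basis s e) (products_1 (dscale s) (dE e) (dF s e) k) dbr"
    by (rule double_has_productsI)
      (simp_all add: products_1_def dE_eq dF_eq double_enum_def double_of_linear atLeastAtMost_1_8
        model_simps rows del: One_nat_def)
  moreover have "bialgebra_B1 s e k abr cobr"
    unfolding bialgebra_B1_def
    by (intro conjI abr_has_productsI)
      (simp_all add: cobr_e alt_tensor_simps atLeastAtMost_1_4 abr_e vector_of_eq_e_iff model_simps rows del: One_nat_def)
  ultimately show ?thesis using corresponds pseudo_metric_double by blast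
qed

lemma bialgebra_B2_double:
  "\<exists>br \<Delta> dbr. bialgebra_B2 s e k1 k2 k3 c1 c2 c3 br \<Delta> \<and>
    pseudo_metric_three_lie_algebra (dscale s) (double_space s) dbr form_plus \<and>
    has_products (double_basis s e) (products_2 (dscale s) (dE e) (dF s e) k1 k2 k3 c1 c2 c3) dbr \<and>
    corresponds_to_bialgebra s dbr br \<Delta>"
proof -
  define S where "S = vec4 (- unit4 1) 0 0 0"
  \<comment> \<open>Row \<open>i\<close> is the prescribed value of the coproduct on
    \<open>e i\<close>, rewritten by \<open>wedge3_eq\<close>.\<close>
  define T where "T = vec4 0 (c1 *s unit4 2 - k2 *s unit4 3 + k1 *s unit4 4) (- k2 *s unit4 2 - c2 *s unit4 3 + k3 *s unit4 4) (k1 *s unit4 2 + k3 *s unit4 3 + c3 *s unit4 4)"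
  have rows: "S$1 = - unit4 1" "S$2 = 0" "S$3 = 0" "S$4 = 0"
    "T$1 = 0"
    "T$2 = c1 *s unit4 2 - k2 *s unit4 3 + k1 *s unit4 4"
    "T$3 = - k2 *s unit4 2 - c2 *s unit4 3 + k3 *s unit4 4"
    "T$4 = k1 *s unit4 2 + k3 *s unit4 3 + c3 *s unit4 4"
    by (simp_all add: S_def T_def)
  \<comment> \<open>\<open>S\<close> lives on the first coordinate and \<open>T\<close> on the other
    three, so both products vanish.\<close>
  interpret bialgebra_coordinates s e S T 0
    by unfold_locales (simp_all add: rows transpose_def vec4_eq_iff mult_vec4_nth)
  have "has_products (double_basis s e) (products_2 (dscale s) (dE e) (dF s e) k1 k2 k3 c1 c2 c3) dbr"
    by (rule double_has_productsI)
      (simp_all add: products_2_def dE_eq dF_eq double_enum_def double_of_linear atLeastAtMost_1_8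
        model_simps rows del: One_nat_def)
  moreover have "bialgebra_B2 s e k1 k2 k3 c1 c2 c3 abr cobr"
    unfolding bialgebra_B2_def
    by (intro conjI abr_has_productsI)
      (simp_all add: cobr_e alt_tensor_simps atLeastAtMost_1_4 abr_e vector_of_eq_e_iff model_simps rows del: One_nat_def)
  ultimately show ?thesis using corresponds pseudo_metric_double by blast
qed

lemma bialgebra_B3_double:
  "\<exists>br \<Delta> dbr. bialgebra_B3 s e k c1 c2 br \<Delta> \<and>
    pseudo_metric_three_lie_algebra (dscale s) (double_space s) dbr form_plus \<and>
    has_products (double_basis s e) (products_3 (dscale s) (dE e) (dF s e) k c1 c2) dbr \<and>
    corresponds_to_bialgebra s dbr br \<Delta>"
proof -
  define S where "S = vec4 (- unit4 1) (unit4 2) 0 0"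
  define T where "T = vec4 0 0 (- c1 *s unit4 3 + k *s unit4 4) (k *s unit4 3 + c2 *s unit4 4)"
  have rows: "S$1 = - unit4 1" "S$2 = unit4 2" "S$3 = 0" "S$4 = 0"
    "T$1 = 0"
    "T$2 = 0"
    "T$3 = - c1 *s unit4 3 + k *s unit4 4"
    "T$4 = k *s unit4 3 + c2 *s unit4 4"
    by (simp_all add: S_def T_def)
  \<comment> \<open>\<open>S\<close> lives on the first two coordinates and \<open>T\<close> on the
    last two, hence \<open>l = 0\<close>.\<close>
  interpret bialgebra_coordinates s e S T 0
    by unfold_locales (simp_all add: rows transpose_def vec4_eq_iff mult_vec4_nth)
  have "has_products (double_basis s e) (products_3 (dscale s) (dE e) (dF s e) k c1 c2) dbr"
    by (rule double_has_productsI)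
      (simp_all add: products_3_def dE_eq dF_eq double_enum_def double_of_linear atLeastAtMost_1_8
        model_simps rows del: One_nat_def)
  moreover have "bialgebra_B3 s e k c1 c2 abr cobr"
    unfolding bialgebra_B3_def
    by (intro conjI abr_has_productsI)
      (simp_all add: cobr_e alt_tensor_simps atLeastAtMost_1_4 abr_e vector_of_eq_e_iff model_simps rows del: One_nat_def)
  ultimately show ?thesis using corresponds pseudo_metric_double by blast
qed

lemma bialgebra_B4_double:
  "\<exists>br \<Delta> dbr. bialgebra_B4 s e c br \<Delta> \<and>
    pseudo_metric_three_lie_algebra (dscale s) (double_space s) dbr form_plus \<and>
    has_products (double_basis s e) (products_4 (dscale s) (dE e) (dF s e) c) dbr \<and>
    corresponds_to_bialgebra s dbr br \<Delta>"
proof -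
  define S where "S = vec4 (- unit4 1) (unit4 2) (- unit4 3) 0"
  define T where "T = vec4 0 0 0 (c *s unit4 4)"
  have rows: "S$1 = - unit4 1" "S$2 = unit4 2" "S$3 = - unit4 3" "S$4 = 0"
    "T$1 = 0"
    "T$2 = 0"
    "T$3 = 0"
    "T$4 = c *s unit4 4"
    by (simp_all add: S_def T_def)
  \<comment> \<open>\<open>S\<close> lives on the first three coordinates and \<open>T\<close> on
    the fourth, hence \<open>l = 0\<close>.\<close>
  interpret bialgebra_coordinates s e S T 0
    by unfold_locales (simp_all add: rows transpose_def vec4_eq_iff mult_vec4_nth)
  have "has_products (double_basis s e) (products_4 (dscale s) (dE e) (dF s e) c) dbr"
    by (rule double_has_productsI)
      (simp_all add: products_4_def dE_eq dF_eq double_enum_def double_of_linear atLeastAtMost_1_8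
        model_simps rows del: One_nat_def)
  moreover have "bialgebra_B4 s e c abr cobr"
    unfolding bialgebra_B4_def
    by (intro conjI abr_has_productsI)
      (simp_all add: cobr_e alt_tensor_simps atLeastAtMost_1_4 abr_e vector_of_eq_e_iff model_simps rows del: One_nat_def)
  ultimately show ?thesis using corresponds pseudo_metric_double by blast
qed

end

theorem theorem4p10:
  fixes s :: "complex \<Rightarrow> 'a::ab_group_add \<Rightarrow> 'a" and e :: "nat \<Rightarrow> 'a"
  assumes "vector_space s" and "basis4 s e"
  shows
    "vector_space.dim (dscale s) (double_space s) = 8 \<and>
     (\<forall>i\<in>{1..4}. \<forall>j\<in>{1..4}.
        form_plus (dE e i) (dE e j) = 0 \<and>
        form_plus (dE e i) (dF s e j) = (if i = j then 1 else 0) \<and>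
        form_plus (dF s e i) (dE e j) = (if i = j then 1 else 0) \<and>
        form_plus (dF s e i) (dF s e j) = 0) \<and>
     (\<forall>k. \<exists>br \<Delta> dbr.
        bialgebra_B1 s e k br \<Delta> \<and>
        pseudo_metric_three_lie_algebra (dscale s) (double_space s) dbr form_plus \<and>
        has_products (double_basis s e) (products_1 (dscale s) (dE e) (dF s e) k) dbr \<and>
        corresponds_to_bialgebra s dbr br \<Delta>) \<and>
     (\<forall>k1 k2 k3 c1 c2 c3. \<exists>br \<Delta> dbr.
        bialgebra_B2 s e k1 k2 k3 c1 c2 c3 br \<Delta> \<and>
        pseudo_metric_three_lie_algebra (dscale s) (double_space s) dbr form_plus \<and>
        has_products (double_basis s e)
          (products_2 (dscale s) (dE e) (dF s e) k1 k2 k3 c1 c2 c3) dbr \<and>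
        corresponds_to_bialgebra s dbr br \<Delta>) \<and>
     (\<forall>k c1 c2. \<exists>br \<Delta> dbr.
        bialgebra_B3 s e k c1 c2 br \<Delta> \<and>
        pseudo_metric_three_lie_algebra (dscale s) (double_space s) dbr form_plus \<and>
        has_products (double_basis s e) (products_3 (dscale s) (dE e) (dF s e) k c1 c2) dbr \<and>
        corresponds_to_bialgebra s dbr br \<Delta>) \<and>
     (\<forall>c. \<exists>br \<Delta> dbr.
        bialgebra_B4 s e c br \<Delta> \<and>
        pseudo_metric_three_lie_algebra (dscale s) (double_space s) dbr form_plus \<and>
        has_products (double_basis s e) (products_4 (dscale s) (dE e) (dF s e) c) dbr \<and>
        corresponds_to_bialgebra s dbr br \<Delta>)"
proof -
  interpret basis4_space s e
    using assms by (simp add: basis4_space_def basis4_space_axioms_def)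
  have "form_plus (dE e i) (dE e j) = 0 \<and>
      form_plus (dE e i) (dF s e j) = (if i = j then 1 else 0) \<and>
      form_plus (dF s e i) (dE e j) = (if i = j then 1 else 0) \<and>
      form_plus (dF s e i) (dF s e j) = 0" if "i \<in> {1..4}" "j \<in> {1..4}" for i j
    using dual_basis_basis[OF that] dual_basis_basis[OF that(2,1)] dual_linear(3)[OF dual_basis_dual]
    by (simp add: form_plus_def dE_def dF_def)
  then show ?thesis
    by (intro conjI[OF dim_double] conjI allI ballI bialgebra_B1_double bialgebra_B2_double
        bialgebra_B3_double bialgebra_B4_double) blast+
qed

end
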